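(* Let $d\ge 1$ and let $\{\eta(x):x\in\mathbb{Z}^d\}$ be i.i.d. random variables with values in $\{0,1,2,\dots\}$ and law $\nu$ (product measure). Suppose that for some $0<\delta<d$ and all $n$ large enough, \[ \mathbf{P}[\eta(x)\ge n]\ge(\log n)^{-\delta}. \] Let $\mathfrak{D}=\{x\in\mathbb{R}^d: |x^{(1)}|+\dots+|x^{(d)}|\le 1\}$. Then for $\nu$-almost every initial configuration $\omega$, conditioned on $\{\eta(0)\ge1\}$, for every $0<\varepsilon<1$, \[ (1-\varepsilon)\mathfrak{D}\subset\frac{\bar\xi_n}{n}\subset(1+\varepsilon)\mathfrak{D} \] for all $n$ large enough, $\mathbf{P}_\omega$-almost surely.
   Context: Frog model: given an initial configuration $\omega\in\{0,1,2,\dots\}^{\mathbb{Z}^d}$, site $x$ initially holds $\omega(x)$ particles. For each $x\in\mathbb{Z}^d$ and $1\le k\le\omega(x)$ let $(S^x_{n,k})_{n\ge0}$ be independent discrete-time simple random walks on $\mathbb{Z}^d$ with $S^x_{0,k}=x$; these are the trajectories the particles follow once activated. $\mathbf{P}_\omega$ denotes the law of these walks for fixed $\omega$. At time $0$ only the particles at the origin are active; whenever an active particle visits a site, all sleeping particles there become active. Formally, $t(x,z)=\min\{n: S^x_{n,k}=z\text{ for some }1\le k\le\omega(x)\}$ ($=\infty$ if none), $T(x,z)=\inf\sum_{i=1}^m t(x_{i-1},x_i)$ over all finite sequences $x=x_0,\dots,x_m=z$ in $\mathbb{Z}^d$, $\xi_n=\{y\in\mathbb{Z}^d:T(0,y)\le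 n\}$ and $\bar\xi_n=\bigcup_{y\in\xi_n}(y+(-1/2,1/2]^d)\subset\mathbb{R}^d$. *)

theory Defs
  imports "HOL-Probability.Probability" "HOL-Library.Extended_Nat"
begin

definition unit_steps :: "(int ^ 'd::finite) set" where
  "unit_steps = {axis i 1 | i. True} \<union> {axis i (-1) | i. True}"

definition srw_increments :: "(nat \<Rightarrow> int ^ 'd::finite) measure" where
  "srw_increments = PiM (UNIV :: nat set) (\<lambda>_. measure_pmf (pmf_of_set unit_steps))"

definition walk_space :: "(int ^ 'd::finite \<Rightarrow> nat) \<Rightarrow> (((int ^ 'd) \<times> nat) \<Rightarrow> nat \<Rightarrow> int ^ 'd) measure" where
  "walk_space \<omega> = PiM {(x, k). 1 \<le> k \<and> k \<le> \<omega> x} (\<lambda>_. srw_increments)"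

definition walk :: "(((int ^ 'd::finite) \<times> nat) \<Rightarrow> nat \<Rightarrow> int ^ 'd) \<Rightarrow> int ^ 'd \<Rightarrow> nat \<Rightarrow> nat \<Rightarrow> int ^ 'd" where
  "walk w x k n = x + (\<Sum>i<n. w (x, k) i)"

definition frog_t :: "(int ^ 'd::finite \<Rightarrow> nat) \<Rightarrow> (((int ^ 'd) \<times> nat) \<Rightarrow> nat \<Rightarrow> int ^ 'd) \<Rightarrow> int ^ 'd \<Rightarrow> int ^ 'd \<Rightarrow> enat" where
  "frog_t \<omega> w x z =
     (if \<exists>k n. 1 \<le> k \<and> k \<le> \<omega> x \<and> walk w x k n = z
      then enat (LEAST n. \<exists>k. 1 \<le> k \<and> k \<le> \<omega> x \<and> walk w x k n = z)
      else \<infinity>)"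

definition frog_T :: "(int ^ 'd::finite \<Rightarrow> nat) \<Rightarrow> (((int ^ 'd) \<times> nat) \<Rightarrow> nat \<Rightarrow> int ^ 'd) \<Rightarrow> int ^ 'd \<Rightarrow> int ^ 'd \<Rightarrow> enat" where
  "frog_T \<omega> w x z =
     (INF xs \<in> {xs. xs \<noteq> [] \<and> hd xs = x \<and> last xs = z}.
        sum_list (map (\<lambda>(a, b). frog_t \<omega> w a b) (zip xs (tl xs))))"

definition frog_xi :: "(int ^ 'd::finite \<Rightarrow> nat) \<Rightarrow> (((int ^ 'd) \<times> nat) \<Rightarrow> nat \<Rightarrow> int ^ 'd) \<Rightarrow> nat \<Rightarrow> (int ^ 'd) set" where
  "frog_xi \<omega> w n = {y. frog_T \<omega> w 0 y \<le> enat n}"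

definition unit_cube_at :: "int ^ 'd::finite \<Rightarrow> (real ^ 'd) set" where
  "unit_cube_at y = {p. \<forall>i. - 1/2 < p $ i - real_of_int (y $ i) \<and> p $ i - real_of_int (y $ i) \<le> 1/2}"

definition frog_xibar :: "(int ^ 'd::finite \<Rightarrow> nat) \<Rightarrow> (((int ^ 'd) \<times> nat) \<Rightarrow> nat \<Rightarrow> int ^ 'd) \<Rightarrow> nat \<Rightarrow> (real ^ 'd) set" where
  "frog_xibar \<omega> w n = (\<Union>y \<in> frog_xi \<omega> w n. unit_cube_at y)"

definition l1_ball :: "(real ^ 'd::finite) set" where
  "l1_ball = {x. (\<Sum>i\<in>UNIV. \<bar>x $ i\<bar>) \<le> 1}"

end

(*
  Some site within distance of order m of any given site carries exp (m powr a) particles, with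
  a > 1, except with probability exp (- m powr c); choosing a > 1 is possible because delta < d.
  So many particles follow, simultaneously, geodesics to all sites within distance m * g m, where
  g m tends to infinity. Once one rich site is reached, the frogs climb from scale to scale and then
  hop along a geodesic from rich site to rich site; each hop gains m * (g m - 2 * d) in distance and
  takes time at most m * g m, so that the asymptotic speed is 1.

  To start, the first particle at the origin visits m ^ d distinct sites for every m. One of them
  is rich at scale m, and by a union bound over these sites (their number is polynomial, whereas
  failures have stretched exponential probability) all larger scales are good around it. This needs
  no information on the range of the walk beyond its being infinite.
*)

theory Submission
  imports Defs "HOL-Real_Asymp.Real_Asymp"
begin

section \<open>Lattice geometry\<close>

text \<open>Two requirements fix the exponent a. Following a prescribed geodesic of length m * g m
  has probability at least (2 * d) powr (- m * g m), so m powr a must outgrow m * g m; as g m tends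
  to infinity, this forces a > 1. A cube of side m has m ^ d sites, each rich with probability at
  least of order m powr (- a * \<delta>), so a * \<delta> < d makes a cube without rich sites very
  unlikely. The obstacle is that the first walk selects the rich site from which everything spreads,
  so this site is random and depends on one of the walks. Two devices remove the dependence. The
  walk is independent of the configuration, so by Fubini its range may be treated as a fixed
  infinite set while the configuration is drawn. And the law of all walks is unchanged when the
  first one is replaced by an independent copy, so its range may also be treated as fixed while the
  other walks are drawn.\<close>

definition l1norm :: "int ^ 'd::finite \<Rightarrow> nat" where
  "l1norm v = (\<Sum>i\<in>UNIV. nat \<bar>v $ i\<bar>)"

text \<open>The base point is a corner and the sides are half-open, which gives exactly m ^ d sites;
  this number becomes the exponent in the probability that no site of the cube is rich.\<close>

definition cube :: "int ^ 'd::finite \<Rightarrow> nat \<Rightarrow> (int ^ 'd) set" where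
  "cube y m = {v. \<forall>i. y $ i \<le> v $ i \<and> v $ i < y $ i + int m}"

lemma l1norm_zero [simp]: "l1norm 0 = 0"
  by (simp add: l1norm_def)

lemma l1norm_eq_0_iff [simp]: "l1norm v = 0 \<longleftrightarrow> v = 0"
  by (auto simp: l1norm_def vec_eq_iff)

lemma l1norm_minus_commute: "l1norm (v - u) = l1norm (u - v)"
  by (simp add: l1norm_def abs_minus_commute)

lemma l1norm_triangle: "l1norm (u + v) \<le> l1norm u + l1norm v"
  by (simp add: l1norm_def sum.distrib[symmetric]) (rule sum_mono, simp)

lemma l1norm_triangle_diff: "l1norm (u - w) \<le> l1norm (u - v) + l1norm (v - w)"
  using l1norm_triangle[of "u - v" "v - w"] by simp

lemma l1norm_axis: "l1norm (axis i c :: int ^ 'd::finite) = nat \<bar>c\<bar>"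
proof -
  have "l1norm (axis i c :: int ^ 'd) = (\<Sum>j\<in>UNIV. if i = j then nat \<bar>c\<bar> else 0)"
    unfolding l1norm_def by (rule sum.cong) (auto simp: axis_def)
  thus ?thesis by simp
qed

lemma l1norm_unit_step: "s \<in> unit_steps \<Longrightarrow> l1norm s = 1"
  by (auto simp: unit_steps_def l1norm_axis)

lemma card_cube: "card (cube (y :: int ^ 'd::finite) m) = m ^ CARD('d)"
proof -
  have "bij_betw vec_nth (cube y m) (Pi\<^sub>E UNIV (\<lambda>i. {y $ i..<y $ i + int m}))"
    by (rule bij_betwI[where g = vec_lambda]) (auto simp: cube_def PiE_def)
  hence "card (cube y m) = card (Pi\<^sub>E UNIV (\<lambda>i. {y $ i..<y $ i + int m}))"
    by (rule bij_betw_same_card)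
  thus ?thesis by (simp add: card_PiE)
qed

lemma finite_cube [simp]: "finite (cube (y :: int ^ 'd::finite) m)"
proof (cases "m = 0")
  case True
  have "v \<notin> cube y 0" for v by (simp add: cube_def not_less)
  hence "cube y 0 = {}" by blast
  with True show ?thesis by simp
next
  case False thus ?thesis using card_cube[of y m] by (intro card_ge_0_finite) simp
qed

lemma l1norm_cube:
  assumes "v \<in> cube (y :: int ^ 'd::finite) m" shows "l1norm (v - y) \<le> CARD('d) * m"
proof -
  have "l1norm (v - y) \<le> (\<Sum>i\<in>(UNIV::'d set). m)" unfolding l1norm_def
  proof (rule sum_mono)
    fix i
    have "y $ i \<le> v $ i" "v $ i < y $ i + int m" using assms by (simp_all add: cube_def)
    thus "nat \<bar>(v - y) $ i\<bar> \<le> m" by simp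
  qed
  thus ?thesis by simp
qed

lemma abs_nth_le_l1norm: "\<bar>v $ i\<bar> \<le> int (l1norm v)"
proof -
  have "nat \<bar>v $ i\<bar> \<le> l1norm v"
    unfolding l1norm_def by (rule member_le_sum) auto
  thus ?thesis by linarith
qed

lemma l1ball_subset_cube:
  "{y. l1norm (y - x) \<le> r} \<subseteq> cube (x - (\<chi> i. int r)) (2 * r + 1)"
proof
  fix y assume "y \<in> {y. l1norm (y - x) \<le> r}"
  hence *: "\<bar>y $ i - x $ i\<bar> \<le> int r" for i
    using abs_nth_le_l1norm[of "y - x" i] by simp
  have "x $ i - int r \<le> y $ i \<and> y $ i < x $ i - int r + int (2 * r + 1)" for i
  proof -
    from *[of i] have "y $ i - x $ i \<le> int r" "- (y $ i - x $ i) \<le> int r"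
      unfolding abs_le_iff by blast+
    thus ?thesis by simp
  qed
  thus "y \<in> cube (x - (\<chi> i. int r)) (2 * r + 1)"
    unfolding cube_def by simp
qed

lemma finite_l1ball [simp]: "finite {y. l1norm (y - x) \<le> r}"
  using finite_subset[OF l1ball_subset_cube finite_cube] .

lemma card_l1ball: "card {y :: int ^ 'd::finite. l1norm (y - x) \<le> r} \<le> (2 * r + 1) ^ CARD('d)"
  using card_mono[OF finite_cube l1ball_subset_cube[of x r]] by (simp add: card_cube)

lemma card_unit_steps: "card (unit_steps :: (int ^ 'd::finite) set) \<le> 2 * CARD('d)"
proof -
  have eq: "(unit_steps :: (int ^ 'd::finite) set) = range (\<lambda>i. axis i 1) \<union> range (\<lambda>i. axis i (- 1))"
    by (auto simp: unit_steps_def)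
  show ?thesis unfolding eq
    using card_Un_le[of "range (\<lambda>i::'d. axis i (1::int))" "range (\<lambda>i. axis i (- 1))"]
      card_image_le[of "UNIV::'d set" "\<lambda>i::'d. axis i (1::int)"]
      card_image_le[of "UNIV::'d set" "\<lambda>i::'d. axis i (- 1::int)"]
    by simp
qed

lemma finite_unit_steps [simp]: "finite (unit_steps :: (int ^ 'd::finite) set)"
proof -
  have eq: "(unit_steps :: (int ^ 'd::finite) set) = range (\<lambda>i. axis i 1) \<union> range (\<lambda>i. axis i (- 1))"
    by (auto simp: unit_steps_def)
  show ?thesis unfolding eq by simp
qed

lemma axis_in_unit_steps [simp]: "axis i 1 \<in> unit_steps" "axis i (- 1) \<in> unit_steps"
  by (auto simp: unit_steps_def)

lemma unit_steps_nonempty [simp]: "unit_steps \<noteq> {}"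
  using axis_in_unit_steps by blast

lemma ex_decreasing_unit_step:
  assumes "v \<noteq> (0 :: int ^ 'd::finite)"
  obtains s where "s \<in> unit_steps" "l1norm v = Suc (l1norm (v - s))"
proof -
  obtain i where i: "v $ i \<noteq> 0" using assms by (auto simp: vec_eq_iff)
  define s :: "int ^ 'd" where "s = axis i (sgn (v $ i))"
  have "l1norm v = nat \<bar>v $ i\<bar> + (\<Sum>j\<in>UNIV - {i}. nat \<bar>v $ j\<bar>)"
    unfolding l1norm_def by (subst sum.remove[of _ i]) auto
  moreover have "l1norm (v - s) = nat \<bar>v $ i - sgn (v $ i)\<bar> + (\<Sum>j\<in>UNIV - {i}. nat \<bar>v $ j\<bar>)"
    unfolding l1norm_def by (subst sum.remove[of _ i]) (auto simp: s_def axis_def)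
  moreover have "nat \<bar>v $ i\<bar> = Suc (nat \<bar>v $ i - sgn (v $ i)\<bar>)"
    using i by (auto simp: sgn_if)
  moreover have "s \<in> unit_steps" using i by (auto simp: s_def sgn_if)
  ultimately show ?thesis by (intro that[of s]) auto
qed

lemma ex_geodesic:
  "\<exists>s :: nat \<Rightarrow> int ^ 'd::finite. (\<forall>i. s i \<in> unit_steps) \<and> (\<Sum>i<l1norm v. s i) = v"
proof (induction "l1norm v" arbitrary: v)
  case 0
  hence "v = 0" by simp
  \<comment> \<open>The sequence has to consist of unit steps beyond the end of the path as well;
    any unit step serves as filler.\<close>
  thus ?case by (intro exI[of _ "\<lambda>_. axis undefined 1"]) simp
next
  case (Suc n)
  hence "v \<noteq> 0" by auto
  then obtain t where t: "t \<in> unit_steps" "l1norm v = Suc (l1norm (v - t))"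
    by (rule ex_decreasing_unit_step)
  with Suc(2) have "n = l1norm (v - t)" by simp
  from Suc(1)[OF this] obtain s where s: "\<forall>i. s i \<in> unit_steps" "(\<Sum>i<l1norm (v - t). s i) = v - t"
    by blast
  show ?case
    by (intro exI[of _ "case_nat t s"])
       (use s t in \<open>auto simp: sum.lessThan_Suc_shift split: nat.split simp del: sum.lessThan_Suc\<close>)
qed

text \<open>One geodesic is fixed for each displacement, so that following it is an event about
  finitely many increments whose probability has an explicit lower bound.\<close>

definition geodesic :: "int ^ 'd::finite \<Rightarrow> nat \<Rightarrow> int ^ 'd" where
  "geodesic v = (SOME s. (\<forall>i. s i \<in> unit_steps) \<and> (\<Sum>i<l1norm v. s i) = v)"

lemma geodesic: "geodesic v i \<in> unit_steps" "(\<Sum>i<l1norm v. geodesic v i) = v"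
  using someI_ex[OF ex_geodesic[of v]] unfolding geodesic_def by auto

lemma l1norm_sum_unit_steps:
  assumes "\<And>i. i < n \<Longrightarrow> s i \<in> unit_steps"
  shows "l1norm (\<Sum>i<n. s i) \<le> n"
  using assms
proof (induction n)
  case (Suc n)
  hence "l1norm (\<Sum>i<n. s i) \<le> n" and "l1norm (s n) = 1"
    by (simp, intro l1norm_unit_step) simp
  thus ?case using l1norm_triangle[of "\<Sum>i<n. s i" "s n"] by simp
qed simp

text \<open>The witness is the site that a geodesic from \<open>u\<close> to \<open>z\<close>
  reaches after \<open>j\<close> steps.\<close>

lemma ex_between:
  assumes "j \<le> l1norm (z - u)"
  obtains v where "l1norm (v - u) \<le> j" "l1norm (z - v) \<le> l1norm (z - u) - j"
proof
  define s where "s = geodesic (z - u)"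
  let ?n = "l1norm (z - u)"
  show "l1norm ((u + (\<Sum>i<j. s i)) - u) \<le> j"
    using l1norm_sum_unit_steps[of j s] by (simp add: s_def geodesic)
  have "(\<Sum>i<j + k. s i) = (\<Sum>i<j. s i) + (\<Sum>i<k. s (i + j))" for k
    by (induction k) (simp_all add: ac_simps)
  from this[of "?n - j"] have "(\<Sum>i<?n. s i) = (\<Sum>i<j. s i) + (\<Sum>i<?n - j. s (i + j))"
    using assms by simp
  hence "z - (u + (\<Sum>i<j. s i)) = (\<Sum>i<?n - j. s (i + j))"
    using geodesic(2)[of "z - u"] by (simp add: s_def algebra_simps)
  thus "l1norm (z - (u + (\<Sum>i<j. s i))) \<le> ?n - j"
    using l1norm_sum_unit_steps[of "?n - j" "\<lambda>i. s (i + j)"] by (simp add: s_def geodesic)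
qed

section \<open>Passage times\<close>

definition path_time :: "(int ^ 'd::finite \<Rightarrow> nat) \<Rightarrow> (((int ^ 'd) \<times> nat) \<Rightarrow> nat \<Rightarrow> int ^ 'd) \<Rightarrow> (int ^ 'd) list \<Rightarrow> enat" where
  "path_time \<omega> w xs = sum_list (map (\<lambda>(a, b). frog_t \<omega> w a b) (zip xs (tl xs)))"

lemma path_time_simps:
  "path_time \<omega> w [] = 0"
  "path_time \<omega> w [x] = 0"
  "path_time \<omega> w (x # y # xs) = frog_t \<omega> w x y + path_time \<omega> w (y # xs)"
  by (simp_all add: path_time_def)

lemma path_time_append: "path_time \<omega> w (us @ y # vs) = path_time \<omega> w (us @ [y]) + path_time \<omega> w (y # vs)"
  by (induction us rule: induct_list012) (simp_all add: path_time_simps add.assoc)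

lemma frog_T_le_path_time:
  assumes "xs \<noteq> []" "hd xs = x" "last xs = z"
  shows "frog_T \<omega> w x z \<le> path_time \<omega> w xs"
  unfolding frog_T_def path_time_def by (intro INF_lower CollectI conjI assms)

lemma frog_T_le_frog_t: "frog_T \<omega> w x z \<le> frog_t \<omega> w x z"
  using frog_T_le_path_time[of "[x, z]" x z \<omega> w] by (simp add: path_time_simps)

text \<open>\<open>enat\<close> is well-ordered, so the infimum is a minimum, infinite values
  included. The triangle inequality then follows by concatenating two optimal paths.\<close>

lemma frog_T_attained:
  obtains xs where "xs \<noteq> []" "hd xs = x" "last xs = z" "frog_T \<omega> w x z = path_time \<omega> w xs"
proof -
  let ?S = "{xs. xs \<noteq> [] \<and> hd xs = x \<and> last xs = z}"
  have "path_time \<omega> w [x, z] \<in> path_time \<omega> w ` ?S" by (rule imageI) simp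
  hence "Inf (path_time \<omega> w ` ?S) \<in> path_time \<omega> w ` ?S" by (rule wellorder_InfI)
  then obtain xs where "xs \<in> ?S" "Inf (path_time \<omega> w ` ?S) = path_time \<omega> w xs" by (rule imageE)
  thus ?thesis by (intro that[of xs]) (simp_all add: frog_T_def path_time_def)
qed

lemma frog_T_triangle: "frog_T \<omega> w x z \<le> frog_T \<omega> w x y + frog_T \<omega> w y z"
proof -
  obtain xs where xs: "xs \<noteq> []" "hd xs = x" "last xs = y" "frog_T \<omega> w x y = path_time \<omega> w xs"
    by (rule frog_T_attained)
  obtain ys where ys: "ys \<noteq> []" "hd ys = y" "last ys = z" "frog_T \<omega> w y z = path_time \<omega> w ys"
    by (rule frog_T_attained)
  obtain us where us: "xs = us @ [y]" using append_butlast_last_id[OF xs(1)] unfolding xs(3) by (rule that[OF sym])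
  obtain vs where vs: "ys = y # vs" using list.collapse[OF ys(1)] unfolding ys(2) by (rule that[OF sym])
  have "frog_T \<omega> w x z \<le> path_time \<omega> w (us @ y # vs)"
    using xs(2) ys(3) unfolding us vs by (intro frog_T_le_path_time) (auto simp: hd_append)
  also have "\<dots> = path_time \<omega> w xs + path_time \<omega> w ys"
    unfolding us vs by (rule path_time_append)
  finally show ?thesis unfolding xs(4) ys(4) .
qed

lemma frog_T_trans:
  assumes "frog_T \<omega> w x y \<le> enat m" "frog_T \<omega> w y z \<le> enat n"
  shows "frog_T \<omega> w x z \<le> enat (m + n)"
  using frog_T_triangle[of \<omega> w x z y] add_mono[OF assms] by simp

lemma frog_t_le:
  assumes "1 \<le> k" "k \<le> \<omega> x" "walk w x k n = z"
  shows "frog_t \<omega> w x z \<le> enat n"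
  using assms unfolding frog_t_def by (auto intro!: Least_le)

lemma l1norm_le_frog_t:
  assumes "\<And>k i. 1 \<le> k \<Longrightarrow> k \<le> \<omega> x \<Longrightarrow> w (x, k) i \<in> unit_steps"
  shows "enat (l1norm (z - x)) \<le> frog_t \<omega> w x z"
proof (cases "\<exists>k n. 1 \<le> k \<and> k \<le> \<omega> x \<and> walk w x k n = z")
  case True
  let ?P = "\<lambda>n. \<exists>k. 1 \<le> k \<and> k \<le> \<omega> x \<and> walk w x k n = z"
  define N where "N = (LEAST n. ?P n)"
  have "?P N" unfolding N_def by (rule LeastI_ex) (use True in blast)
  then obtain k where k: "1 \<le> k" "k \<le> \<omega> x" "walk w x k N = z" by blast
  have "z - x = (\<Sum>i<N. w (x, k) i)" using k(3) by (auto simp: walk_def)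
  hence "l1norm (z - x) \<le> N"
    using l1norm_sum_unit_steps[of N "w (x, k)"] assms k(1,2) by simp
  moreover have "frog_t \<omega> w x z = enat N" using True unfolding frog_t_def N_def by (rule if_P)
  ultimately show ?thesis by simp
next
  case False
  hence "frog_t \<omega> w x z = \<infinity>" unfolding frog_t_def by (rule if_not_P)
  thus ?thesis by simp
qed

text \<open>Each particle advances at most one unit per time step, and no relay of particles can do
  better: the bound adds up along an optimal path. This is the source of the outer
  inclusion.\<close>

lemma l1norm_le_frog_T:
  assumes "\<And>x k i. 1 \<le> k \<Longrightarrow> k \<le> \<omega> x \<Longrightarrow> w (x, k) i \<in> unit_steps"
  shows "enat (l1norm (z - x)) \<le> frog_T \<omega> w x z"
proof -
  obtain xs where xs: "xs \<noteq> []" "hd xs = x" "last xs = z" "frog_T \<omega> w x z = path_time \<omega> w xs"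
    by (rule frog_T_attained)
  have "enat (l1norm (last us - hd us)) \<le> path_time \<omega> w us" if "us \<noteq> []" for us
    using that
  proof (induction us rule: induct_list012)
    case (3 u v us)
    have "enat (l1norm (last (u # v # us) - u)) \<le> enat (l1norm (v - u)) + enat (l1norm (last (v # us) - v))"
      using l1norm_triangle_diff[of "last (v # us)" u v] by simp
    also have "\<dots> \<le> frog_t \<omega> w u v + path_time \<omega> w (v # us)"
    proof (rule add_mono)
      show "enat (l1norm (v - u)) \<le> frog_t \<omega> w u v" by (rule l1norm_le_frog_t) (rule assms)
      show "enat (l1norm (last (v # us) - v)) \<le> path_time \<omega> w (v # us)" using "3.IH"(2) by simp
    qed
    finally show ?case by (simp only: path_time_simps list.sel)
  qed (simp_all add: path_time_simps zero_enat_def[symmetric])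
  from this[OF xs(1)] show ?thesis unfolding xs .
qed

section \<open>Multiscale spreading from a good site, without probability\<close>

definition good_site :: "(nat \<Rightarrow> nat) \<Rightarrow> (int ^ 'd::finite \<Rightarrow> nat) \<Rightarrow> int ^ 'd \<Rightarrow> nat \<Rightarrow> bool" where
  "good_site L \<omega> x K \<longleftrightarrow> L K \<le> \<omega> x \<and>
     (\<forall>m\<ge>K. \<forall>y. l1norm (y - x) \<le> m ^ 4 \<longrightarrow> (\<exists>v\<in>cube y m. L m \<le> \<omega> v))"

text \<open>The window m ^ 4, here and in \<open>good_site\<close>, is polynomial, which keeps union
  bounds cheap, yet larger than what scale m has to serve: climbing to scale m stays within CARD('d)
  * m ^ 2 of \<open>x\<close>, and targets will lie at distances of order m ^ 3.\<close>

definition fast_around :: "(nat \<Rightarrow> nat) \<Rightarrow> (nat \<Rightarrow> nat) \<Rightarrow> (int ^ 'd::finite \<Rightarrow> nat) \<Rightarrow> ((int ^ 'd) \<times> nat \<Rightarrow> nat \<Rightarrow> int ^ 'd)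
    \<Rightarrow> int ^ 'd \<Rightarrow> nat \<Rightarrow> bool" where
  "fast_around L g \<omega> w x K \<longleftrightarrow>
     (\<forall>m\<ge>K. \<forall>y. l1norm (y - x) \<le> m ^ 4 \<longrightarrow> L m \<le> \<omega> y \<longrightarrow>
        (\<forall>z. l1norm (z - y) \<le> m * g m \<longrightarrow> frog_T \<omega> w y z \<le> enat (l1norm (z - y))))"

text \<open>A rich site for scale m + 1 is sought in the cube of side m + 1 attached to the current
  site. It is at distance at most CARD('d) * (m + 1) \<le> 2 * CARD('d) * m \<le> m * g m, hence
  within reach of the particles of scale m. The costs CARD('d) * (m + 1) of the single rises are the
  increments that make up the quadratic bound.\<close>

lemma climb:
  fixes x :: "int ^ 'd::finite"
  assumes good: "good_site L \<omega> x K" and fast: "fast_around L g \<omega> w x K"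
    and K: "\<And>m. m \<ge> K \<Longrightarrow> CARD('d) \<le> m \<and> 2 * CARD('d) \<le> g m"
    and "K \<le> m"
  shows "\<exists>u. L m \<le> \<omega> u \<and> l1norm (u - x) \<le> CARD('d) * m\<^sup>2 \<and> frog_T \<omega> w x u \<le> enat (CARD('d) * m\<^sup>2)"
  using \<open>K \<le> m\<close>
proof (induction m rule: dec_induct)
  case base
  have "frog_T \<omega> w x x \<le> enat (l1norm (x - x))"
    using fast[unfolded fast_around_def, rule_format, of K x x] good
    by (simp add: good_site_def)
  hence "frog_T \<omega> w x x \<le> enat (CARD('d) * K\<^sup>2)"
    by (rule order_trans) simp
  thus ?case using good by (intro exI[of _ x]) (simp add: good_site_def)
next
  case (step m)
  let ?d = "CARD('d)"
  from step.IH obtain u where u: "L m \<le> \<omega> u" "l1norm (u - x) \<le> ?d * m\<^sup>2" "frog_T \<omega> w x u \<le> enat (?d * m\<^sup>2)"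
    by blast
  have dm: "?d \<le> m" "2 * ?d \<le> g m" using K[OF step.hyps(1)] by auto
  have d1: "1 \<le> ?d" by (simp add: Suc_le_eq)
  have "?d * m\<^sup>2 \<le> m ^ 3" using mult_right_mono[OF dm(1), of "m\<^sup>2"] by (simp add: power3_eq_cube power2_eq_square)
  also have "\<dots> \<le> m ^ 4" using d1 dm(1) by (intro power_increasing) linarith+
  finally have um: "l1norm (u - x) \<le> m ^ 4" using u(2) by simp
  hence "l1norm (u - x) \<le> (Suc m) ^ 4" by (rule order_trans) (simp add: power_mono)
  then obtain v where v: "v \<in> cube u (Suc m)" "L (Suc m) \<le> \<omega> v"
    using good le_SucI[OF step.hyps(1)] unfolding good_site_def by blast
  have vu: "l1norm (v - u) \<le> ?d * Suc m" using l1norm_cube[OF v(1)] .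
  also have "\<dots> \<le> ?d * (2 * m)" by (rule mult_left_mono) (use d1 dm(1) in linarith)+
  also have "\<dots> = m * (2 * ?d)" by simp
  also have "\<dots> \<le> m * g m" using dm by simp
  finally have "frog_T \<omega> w u v \<le> enat (l1norm (v - u))"
    using fast u(1) um step.hyps(1) unfolding fast_around_def by blast
  hence "frog_T \<omega> w u v \<le> enat (?d * Suc m)" by (rule order_trans) (use vu in simp)
  from frog_T_trans[OF u(3) this] have t: "frog_T \<omega> w x v \<le> enat (?d * m\<^sup>2 + ?d * Suc m)" .
  have le: "?d * m\<^sup>2 + ?d * Suc m \<le> ?d * (Suc m)\<^sup>2" by (simp add: power2_eq_square algebra_simps)
  have "l1norm (v - x) \<le> ?d * (Suc m)\<^sup>2"
    using l1norm_triangle_diff[of v x u] vu u(2) le by linarith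
  moreover have "frog_T \<omega> w x v \<le> enat (?d * (Suc m)\<^sup>2)"
    using t by (rule order_trans) (use le in simp)
  ultimately show ?case using v(2) by blast
qed

text \<open>Induction on the distance to the target. The conclusion says that time exceeds distance
  by a factor of at most g m / (g m - 2 * CARD('d)), cleared of denominators. \<open>N\<close>
  bounds the remaining distance; as this only decreases, all intermediate sites stay in the window
  around \<open>x\<close>.\<close>

lemma hop:
  fixes x :: "int ^ 'd::finite"
  assumes good: "good_site L \<omega> x K" and fast: "fast_around L g \<omega> w x K"
    and m: "K \<le> m" "1 \<le> m" "2 * CARD('d) < g m"
    and bound: "N + l1norm (z - x) \<le> m ^ 4"
  shows "L m \<le> \<omega> u \<Longrightarrow> l1norm (z - u) \<le> N \<Longrightarrow>
    \<exists>t. frog_T \<omega> w u z \<le> enat t \<and> t * (g m - 2 * CARD('d)) \<le> l1norm (z - u) * g m"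
proof (induction "l1norm (z - u)" arbitrary: u rule: less_induct)
  case less
  let ?d = "CARD('d)"
  have near: "l1norm (y - x) \<le> m ^ 4" if "l1norm (z - y) \<le> N" for y
    using l1norm_triangle_diff[of y x z] that bound l1norm_minus_commute[of y z] by linarith
  show ?case
  proof (cases "l1norm (z - u) \<le> m * g m")
    case True
    hence "frog_T \<omega> w u z \<le> enat (l1norm (z - u))"
      using fast near[OF less.prems(2)] m(1) less.prems(1) unfolding fast_around_def by blast
    thus ?thesis by (intro exI[of _ "l1norm (z - u)"]) simp
  next
    case False
    \<comment> \<open>Aiming short of the full range by CARD('d) * m keeps the whole cube at
      \<open>v\<close> within reach of \<open>u\<close>.\<close>
    let ?j = "m * (g m - ?d)"
    have le: "?j + ?d * m \<le> m * g m" using m(3) by (simp add: algebra_simps diff_mult_distrib2)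
    have "?j \<le> l1norm (z - u)" using False le by linarith
    then obtain v where v: "l1norm (v - u) \<le> ?j" "l1norm (z - v) \<le> l1norm (z - u) - ?j"
      by (rule ex_between)
    have "l1norm (z - v) \<le> N" using v less.prems by linarith
    then obtain y where y: "y \<in> cube v m" "L m \<le> \<omega> y"
      using good near m(1) unfolding good_site_def by blast
    have yv: "l1norm (y - v) \<le> ?d * m" by (rule l1norm_cube[OF y(1)])
    have yu: "l1norm (y - u) \<le> m * g m"
      using l1norm_triangle_diff[of y u v] yv v(1) le by linarith
    hence "frog_T \<omega> w u y \<le> enat (l1norm (y - u))"
      using fast near[OF less.prems(2)] m(1) less.prems(1) unfolding fast_around_def by blast
    hence Tuy: "frog_T \<omega> w u y \<le> enat (m * g m)" by (rule order_trans) (use yu in simp)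
    have jd: "m * (g m - 2 * ?d) + ?d * m = ?j" using m(3) by (simp add: algebra_simps diff_mult_distrib2)
    \<comment> \<open>The rich site may lie behind \<open>v\<close> by up to CARD('d) * m. This
      second loss of the same size explains the 2 in the progress made.\<close>
    have prog: "l1norm (z - y) + m * (g m - 2 * ?d) \<le> l1norm (z - u)"
      using l1norm_triangle_diff[of z y v] yv v(2) False jd l1norm_minus_commute[of v y] le by linarith
    have "0 < m * (g m - 2 * ?d)" using m by simp
    with prog have "l1norm (z - y) < l1norm (z - u)" by linarith
    from less.hyps[OF this y(2)] obtain t where
      t: "frog_T \<omega> w y z \<le> enat t" "t * (g m - 2 * ?d) \<le> l1norm (z - y) * g m"
      using prog less.prems(2) by force
    have "(m * g m + t) * (g m - 2 * ?d) \<le> (l1norm (z - y) + m * (g m - 2 * ?d)) * g m"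
      using t(2) by (simp add: algebra_simps)
    also have "\<dots> \<le> l1norm (z - u) * g m" by (rule mult_right_mono[OF prog]) simp
    finally show ?thesis using frog_T_trans[OF Tuy t(1)] by blast
  qed
qed

section \<open>The limiting shape\<close>

text \<open>The time splits into \<open>T0\<close>, a climb of order m ^ 2 and the hops. The summand
  CARD('d) in the range of \<open>z\<close> allows for rounding real points to lattice sites
  later.\<close>

lemma eventually_covered:
  fixes x :: "int ^ 'd::finite"
  assumes good: "good_site L \<omega> x K" and fast: "fast_around L g \<omega> w x K"
    and K: "\<And>m. m \<ge> K \<Longrightarrow> CARD('d) \<le> m \<and> 2 * CARD('d) < g m"
    and g: "filterlim g at_top sequentially"
    and T0: "frog_T \<omega> w 0 x \<le> enat T0"
    and \<epsilon>: "0 < \<epsilon>" "\<epsilon> < 1"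
  shows "eventually (\<lambda>n. \<forall>z. real (l1norm z) \<le> (1 - \<epsilon>) * real n + real CARD('d) \<longrightarrow> frog_T \<omega> w 0 z \<le> enat n) sequentially"
proof -
  let ?d = "CARD('d)"
  \<comment> \<open>At scale m near n powr (1 / 3) the climb costs order n powr (2 / 3), negligible
    against n, while distances of order n stay below m ^ 4. Any exponent strictly between 1 / 4 and
    1 / 2 achieves both.\<close>
  define s where "s n = nat \<lfloor>real n powr (1 / 3)\<rfloor>" for n :: nat
  have s_top: "filterlim s at_top sequentially" unfolding s_def by real_asymp
  define c where "c = real (T0 + l1norm x + ?d)"
  \<comment> \<open>The lower bound on g m brings the factor g m / (g m - 2 * CARD('d)) below 1 +
    \<epsilon> / 2; the polynomial inequality keeps all distances inside the window.\<close>
  have ev_m: "eventually (\<lambda>m. K \<le> m \<and> 4 * real ?d / \<epsilon> + 2 * real ?d \<le> real (g m) \<and>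
      2 * ((real m + 1) ^ 3 + c) + real ?d * real m ^ 2 \<le> real m ^ 4) sequentially"
  proof (intro eventually_conj eventually_ge_at_top)
    show "eventually (\<lambda>m. 4 * real ?d / \<epsilon> + 2 * real ?d \<le> real (g m)) sequentially"
      using filterlim_compose[OF filterlim_real_sequentially g] unfolding filterlim_at_top by blast
    show "eventually (\<lambda>m. 2 * ((real m + 1) ^ 3 + c) + real ?d * real m ^ 2 \<le> real m ^ 4) sequentially"
      by real_asymp
  qed
  have ev_n: "eventually (\<lambda>n. 3 * (c + 2 * real ?d * (real n powr (1 / 3)) ^ 2) \<le> \<epsilon> / 2 * real n) sequentially"
    using \<epsilon>(1) by real_asymp
  show ?thesis
    using eventually_compose_filterlim[OF ev_m s_top] ev_n
  proof eventually_elim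
    case (elim n)
    define m where "m = s n"
    from elim(1) have m: "K \<le> m" "4 * real ?d / \<epsilon> + 2 * real ?d \<le> real (g m)"
      "2 * ((real m + 1) ^ 3 + c) + real ?d * real m ^ 2 \<le> real m ^ 4"
      unfolding m_def by auto
    have m_le: "real m \<le> real n powr (1 / 3)" unfolding m_def s_def by simp
    have "real n powr (1 / 3) \<le> real m + 1" unfolding m_def s_def by linarith
    hence "(real n powr (1 / 3)) ^ 3 \<le> (real m + 1) ^ 3" by (rule power_mono) simp
    moreover have "(real n powr (1 / 3)) ^ 3 = real n" by (cases "n = 0") (simp_all add: powr_power)
    ultimately have n_le: "real n \<le> (real m + 1) ^ 3" by simp
    have "1 \<le> ?d" by (simp add: Suc_le_eq)
    hence m1: "1 \<le> m" using K[OF m(1)] by linarith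
    have m2: "real m ^ 2 \<le> (real n powr (1 / 3)) ^ 2" using m_le by (rule power_mono) simp
    have K': "CARD('d) \<le> m \<and> 2 * CARD('d) \<le> g m" if "K \<le> m" for m
      using K[OF that] by simp
    obtain u where u: "L m \<le> \<omega> u" "l1norm (u - x) \<le> ?d * m\<^sup>2" "frog_T \<omega> w x u \<le> enat (?d * m\<^sup>2)"
      using climb[OF good fast K' m(1)] by blast
    show "\<forall>z. real (l1norm z) \<le> (1 - \<epsilon>) * real n + real ?d \<longrightarrow> frog_T \<omega> w 0 z \<le> enat n"
    proof (intro allI impI)
      fix z :: "int ^ 'd"
      assume z: "real (l1norm z) \<le> (1 - \<epsilon>) * real n + real ?d"
      have "(1 - \<epsilon>) * real n \<le> real n" using \<epsilon> by (simp add: algebra_simps)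
      with z have zn: "real (l1norm z) \<le> real n + real ?d" by linarith
      have zx: "l1norm (z - x) \<le> l1norm z + l1norm x"
        using l1norm_triangle_diff[of z x 0] l1norm_minus_commute[of 0 x] by simp
      define N where "N = l1norm (z - x) + ?d * m\<^sup>2"
      have zu: "l1norm (z - u) \<le> N"
        using l1norm_triangle_diff[of z u x] u(2) l1norm_minus_commute[of x u] unfolding N_def by linarith
      have "real (N + l1norm (z - x)) \<le> 2 * (real (l1norm z) + real (l1norm x)) + real ?d * real m ^ 2"
        using zx unfolding N_def by simp
      also have "\<dots> \<le> real m ^ 4"
        using m(3) zn n_le unfolding c_def by simp
      finally have "N + l1norm (z - x) \<le> m ^ 4"
        by (simp flip: of_nat_power)
      from hop[OF good fast m(1) m1 _ this u(1) zu] K[OF m(1)]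
      obtain t where t: "frog_T \<omega> w u z \<le> enat t" "t * (g m - 2 * ?d) \<le> l1norm (z - u) * g m"
        by blast
      define G where "G = real (g m) - 2 * real ?d"
      have G: "real (g m - 2 * ?d) = G" using K[OF m(1)] by (simp add: G_def of_nat_diff)
      have G0: "0 < G" using K[OF m(1)] by (simp add: G_def)
      have "2 * real ?d \<le> \<epsilon> / 2 * G"
        using m(2) \<epsilon> unfolding G_def by (simp add: field_simps)
      hence gG: "real (g m) \<le> (1 + \<epsilon> / 2) * G" by (simp add: G_def algebra_simps)
      have "t * (g m - 2 * ?d) \<le> N * g m" by (rule le_trans[OF t(2)]) (simp add: zu)
      hence "real t * real (g m - 2 * ?d) \<le> real N * real (g m)"
        by (simp only: of_nat_mult[symmetric] of_nat_le_iff)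
      hence "real t * G \<le> real N * real (g m)" unfolding G .
      also have "\<dots> \<le> real N * ((1 + \<epsilon> / 2) * G)" using gG by (rule mult_left_mono) simp
      finally have "real t \<le> real N * (1 + \<epsilon> / 2)" using G0 by (simp add: mult.assoc[symmetric])
      also have "\<dots> \<le> ((1 - \<epsilon>) * real n + (c + real ?d * real m ^ 2)) * (1 + \<epsilon> / 2)"
      proof (rule mult_right_mono)
        have "real N \<le> real (l1norm z) + real (l1norm x) + real ?d * real m ^ 2"
          using zx unfolding N_def by simp
        thus "real N \<le> (1 - \<epsilon>) * real n + (c + real ?d * real m ^ 2)"
          using z unfolding c_def by simp
      qed (use \<epsilon> in simp)
      also have "\<dots> \<le> (1 - \<epsilon> / 2) * real n + 2 * (c + real ?d * real m ^ 2)"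
      proof -
        have "(1 - \<epsilon>) * (1 + \<epsilon> / 2) \<le> 1 - \<epsilon> / 2" using \<epsilon> by (simp add: algebra_simps)
        hence "(1 - \<epsilon>) * (1 + \<epsilon> / 2) * real n \<le> (1 - \<epsilon> / 2) * real n" by (rule mult_right_mono) simp
        moreover have "(c + real ?d * real m ^ 2) * (1 + \<epsilon> / 2) \<le> (c + real ?d * real m ^ 2) * 2"
          using \<epsilon> by (intro mult_left_mono) (auto simp: c_def)
        ultimately show ?thesis by (simp add: algebra_simps)
      qed
      finally have "real t \<le> (1 - \<epsilon> / 2) * real n + 2 * (c + real ?d * real m ^ 2)" .
      moreover have "real T0 \<le> c" unfolding c_def by simp
      moreover have "real ?d * real m ^ 2 \<le> real ?d * (real n powr (1 / 3)) ^ 2"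
        using m2 by (rule mult_left_mono) simp
      moreover have "(1 - \<epsilon> / 2) * real n = real n - \<epsilon> / 2 * real n" by (simp add: algebra_simps)
      moreover have "0 \<le> real ?d * (real n powr (1 / 3)) ^ 2" by simp
      moreover have "3 * c + 6 * (real ?d * (real n powr (1 / 3)) ^ 2) \<le> \<epsilon> / 2 * real n"
        using elim(2) by (simp add: algebra_simps)
      ultimately have "real T0 + real ?d * real m ^ 2 + real t \<le> real n" unfolding distrib_left by linarith
      hence le: "T0 + ?d * m\<^sup>2 + t \<le> n" by (simp flip: of_nat_power of_nat_mult of_nat_add)
      have "frog_T \<omega> w 0 z \<le> enat (T0 + ?d * m\<^sup>2 + t)"
        by (intro frog_T_trans[OF frog_T_trans[OF T0 u(3)] t(1)])
      thus "frog_T \<omega> w 0 z \<le> enat n" by (rule order_trans) (use le in simp)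
    qed
  qed
qed

section \<open>From lattice sites to the rescaled sets\<close>

lemma l1norm_real: "real (l1norm v) = (\<Sum>i\<in>UNIV. \<bar>real_of_int (v $ i)\<bar>)"
  by (simp add: l1norm_def)

lemma scaled_l1_ball_subset_xibar:
  fixes \<omega> :: "int ^ 'd::finite \<Rightarrow> nat"
  assumes n: "0 < n" and \<epsilon>: "\<epsilon> < 1"
    and cov: "\<forall>z. real (l1norm z) \<le> (1 - \<epsilon>) * real n + real CARD('d) \<longrightarrow> frog_T \<omega> w 0 z \<le> enat n"
  shows "(\<lambda>p. (1 - \<epsilon>) *\<^sub>R p) ` l1_ball \<subseteq> (\<lambda>p. (1 / real n) *\<^sub>R p) ` frog_xibar \<omega> w n"
proof
  fix q assume "q \<in> (\<lambda>p. (1 - \<epsilon>) *\<^sub>R p) ` (l1_ball :: (real ^ 'd) set)"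
  then obtain p :: "real ^ 'd" where p: "(\<Sum>i\<in>UNIV. \<bar>p $ i\<bar>) \<le> 1" "q = (1 - \<epsilon>) *\<^sub>R p"
    by (auto simp: l1_ball_def)
  define r where "r = real n *\<^sub>R q"
  \<comment> \<open>The cubes are open below and closed above, so the matching rounding is the
    ceiling of the coordinate minus 1 / 2.\<close>
  define z :: "int ^ 'd" where "z = (\<chi> i. \<lceil>r $ i - 1 / 2\<rceil>)"
  have z_bounds: "real_of_int (z $ i) - 1 / 2 < r $ i \<and> r $ i \<le> real_of_int (z $ i) + 1 / 2" for i
    unfolding z_def vec_lambda_beta by linarith
  have r_nth: "\<bar>r $ i\<bar> = real n * (1 - \<epsilon>) * \<bar>p $ i\<bar>" for i
    using \<epsilon> by (simp add: r_def p(2) abs_mult)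
  have "real (l1norm z) \<le> (\<Sum>i\<in>UNIV. \<bar>r $ i\<bar> + 1)"
    unfolding l1norm_real
  proof (rule sum_mono)
    fix i show "\<bar>real_of_int (z $ i)\<bar> \<le> \<bar>r $ i\<bar> + 1" using z_bounds[of i] by linarith
  qed
  also have "\<dots> = real n * (1 - \<epsilon>) * (\<Sum>i\<in>UNIV. \<bar>p $ i\<bar>) + real CARD('d)"
    by (simp add: sum.distrib r_nth sum_distrib_left)
  also have "\<dots> \<le> real n * (1 - \<epsilon>) * 1 + real CARD('d)"
    using p(1) \<epsilon> by (intro add_right_mono mult_left_mono) auto
  finally have "frog_T \<omega> w 0 z \<le> enat n" using cov by (simp add: mult.commute)
  moreover have "r \<in> unit_cube_at z"
    unfolding unit_cube_at_def using z_bounds by (smt (verit) mem_Collect_eq field_sum_of_halves)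
  ultimately have "r \<in> frog_xibar \<omega> w n" unfolding frog_xibar_def frog_xi_def by blast
  moreover have "q = (1 / real n) *\<^sub>R r" using n by (simp add: r_def)
  ultimately show "q \<in> (\<lambda>p. (1 / real n) *\<^sub>R p) ` frog_xibar \<omega> w n" by blast
qed

lemma scaled_xibar_subset_l1_ball:
  fixes \<omega> :: "int ^ 'd::finite \<Rightarrow> nat"
  assumes n: "0 < n" and \<epsilon>: "0 < \<epsilon>" "real CARD('d) \<le> \<epsilon> * real n"
    and step: "\<And>x k i. 1 \<le> k \<Longrightarrow> k \<le> \<omega> x \<Longrightarrow> w (x, k) i \<in> unit_steps"
  shows "(\<lambda>p. (1 / real n) *\<^sub>R p) ` frog_xibar \<omega> w n \<subseteq> (\<lambda>p. (1 + \<epsilon>) *\<^sub>R p) ` l1_ball"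
proof
  fix q assume "q \<in> (\<lambda>p. (1 / real n) *\<^sub>R p) ` frog_xibar \<omega> w n"
  then obtain r z where r: "q = (1 / real n) *\<^sub>R r" "frog_T \<omega> w 0 z \<le> enat n" "r \<in> unit_cube_at z"
    by (auto simp: frog_xibar_def frog_xi_def)
  have "enat (l1norm (z - 0)) \<le> frog_T \<omega> w 0 z" by (rule l1norm_le_frog_T) (rule step)
  hence "enat (l1norm z) \<le> enat n" using r(2) by (simp only: diff_zero)
  hence z: "real (l1norm z) \<le> real n" by simp
  have "(\<Sum>i\<in>UNIV. \<bar>r $ i\<bar>) \<le> (\<Sum>i\<in>UNIV. \<bar>real_of_int (z $ i)\<bar> + 1)"
  proof (rule sum_mono)
    fix i
    have "- 1 / 2 < r $ i - real_of_int (z $ i) \<and> r $ i - real_of_int (z $ i) \<le> 1 / 2"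
      using r(3) unfolding unit_cube_at_def by blast
    thus "\<bar>r $ i\<bar> \<le> \<bar>real_of_int (z $ i)\<bar> + 1" by linarith
  qed
  also have "\<dots> = real (l1norm z) + real CARD('d)" by (simp add: sum.distrib l1norm_real)
  also have "\<dots> \<le> (1 + \<epsilon>) * real n" using z \<epsilon> by (simp add: algebra_simps)
  finally have "(\<Sum>i\<in>UNIV. \<bar>r $ i\<bar>) / ((1 + \<epsilon>) * real n) \<le> 1"
    using n \<epsilon> by (simp add: divide_le_eq)
  hence "(1 / ((1 + \<epsilon>) * real n)) *\<^sub>R r \<in> l1_ball"
    using n \<epsilon> by (simp add: l1_ball_def abs_mult sum_divide_distrib)
  moreover have "q = (1 + \<epsilon>) *\<^sub>R ((1 / ((1 + \<epsilon>) * real n)) *\<^sub>R r)"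
    using \<epsilon> r(1) by simp
  ultimately show "q \<in> (\<lambda>p. (1 + \<epsilon>) *\<^sub>R p) ` l1_ball" by blast
qed

section \<open>Range of the simple random walk\<close>

text \<open>A Borel-Cantelli lemma in which the bad events may depend on the starting scale
  \<open>K\<close>; they will, since the candidate sites are chosen according to \<open>K\<close>.
  Failure of \<open>P\<close> lies in every union from \<open>K\<close> on, whose measure is at most
  a tail of the series. As failures are enclosed in a null set, \<open>P\<close> may be any
  predicate.\<close>

lemma AE_of_summable_covers:
  fixes f :: "nat \<Rightarrow> real"
  assumes f: "summable f" "\<And>m. 0 \<le> f m"
    and cov: "\<And>K0. \<exists>K\<ge>K0. \<exists>A. (\<forall>m\<ge>K. A m \<in> sets M \<and> emeasure M (A m) \<le> ennreal (f m)) \<and>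
      (\<forall>x\<in>space M. (\<forall>m\<ge>K. x \<notin> A m) \<longrightarrow> P x)"
  shows "AE x in M. P x"
proof -
  from cov obtain k A where k: "\<And>j::nat. j \<le> k j"
    and A: "\<And>j m. k j \<le> m \<Longrightarrow> A j m \<in> sets M" "\<And>j m. k j \<le> m \<Longrightarrow> emeasure M (A j m) \<le> ennreal (f m)"
    and P: "\<And>j x. x \<in> space M \<Longrightarrow> (\<And>m. k j \<le> m \<Longrightarrow> x \<notin> A j m) \<Longrightarrow> P x"
    by metis
  define B where "B j = (\<Union>m. A j (m + k j))" for j
  have B_sets: "B j \<in> sets M" for j using A by (auto simp: B_def)
  have B_le: "emeasure M (B j) \<le> ennreal (\<Sum>m. f (m + k j))" for j
  proof -
    have "emeasure M (B j) \<le> (\<Sum>m. emeasure M (A j (m + k j)))"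
      unfolding B_def by (rule emeasure_subadditive_countably) (auto intro: A)
    also have "\<dots> \<le> (\<Sum>m. ennreal (f (m + k j)))"
      by (intro suminf_le A) auto
    also have "\<dots> = ennreal (\<Sum>m. f (m + k j))"
      using f by (intro suminf_ennreal2) (auto simp: summable_iff_shift)
    finally show ?thesis .
  qed
  have le_e: "emeasure M (\<Inter>j. B j) \<le> ennreal e" if "0 < e" for e
  proof -
    obtain N where N: "\<And>n. N \<le> n \<Longrightarrow> norm (\<Sum>m. f (m + n)) < e"
      using suminf_exist_split[OF \<open>0 < e\<close> f(1)] by blast
    have "emeasure M (\<Inter>j. B j) \<le> emeasure M (B N)" by (rule emeasure_mono) (auto intro: B_sets)
    also have "\<dots> \<le> ennreal (\<Sum>m. f (m + k N))" by (rule B_le)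
    also have "\<dots> \<le> ennreal e" using N[OF k[of N]] by (intro ennreal_leI) auto
    finally show ?thesis .
  qed
  have "emeasure M (\<Inter>j. B j) \<le> 0" by (rule ennreal_le_epsilon) (simp add: le_e)
  hence "emeasure M (\<Inter>j. B j) = 0" by simp
  moreover have "(\<Inter>j. B j) \<in> sets M" using B_sets by auto
  ultimately have "(\<Inter>j. B j) \<in> null_sets M" by (rule null_setsI)
  moreover have "{x \<in> space M. \<not> P x} \<subseteq> (\<Inter>j. B j)"
  proof
    fix x assume x: "x \<in> {x \<in> space M. \<not> P x}"
    have "x \<in> B j" for j
    proof -
      from x P obtain m where "k j \<le> m" "x \<in> A j m" by blast
      thus ?thesis unfolding B_def by (auto intro!: exI[of _ "m - k j"])
    qed
    thus "x \<in> (\<Inter>j. B j)" by blast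
  qed
  ultimately show ?thesis by (rule AE_I')
qed

text \<open>Independence turns the measure into a product. The form serves twice: the coordinates
  are sites when no site of a set is rich, and particles when none of them follows a given
  geodesic.\<close>

lemma emeasure_PiM_all_le:
  assumes M: "prob_space M" and J: "J \<subseteq> I" "finite J" "n \<le> card J"
    and B: "B \<in> sets M" "measure M B \<le> r" "0 \<le> r" "r \<le> 1"
  shows "emeasure (PiM I (\<lambda>_. M)) {x \<in> space (PiM I (\<lambda>_. M)). \<forall>i\<in>J. x i \<in> B} \<le> ennreal (r ^ n)"
proof -
  interpret M: prob_space M by fact
  interpret P: product_prob_space "\<lambda>_. M" I by unfold_locales
  have "emeasure (PiM I (\<lambda>_. M)) {x \<in> space (PiM I (\<lambda>_. M)). \<forall>i\<in>J. x i \<in> B} = (\<Prod>i\<in>J. emeasure M B)"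
    using J B by (intro P.emeasure_PiM_Collect) auto
  also have "\<dots> = ennreal (measure M B ^ card J)"
    by (simp add: M.emeasure_eq_measure ennreal_power)
  also have "\<dots> \<le> ennreal (r ^ n)"
  proof (rule ennreal_leI)
    have "measure M B ^ card J \<le> r ^ card J" using B by (intro power_mono) auto
    also have "\<dots> \<le> r ^ n" using J B by (intro power_decreasing) auto
    finally show "measure M B ^ card J \<le> r ^ n" .
  qed
  finally show ?thesis .
qed

text \<open>Beyond independence this provides the splitting of an i.i.d. sequence into its first
  entries and a fresh copy of the whole, expressed by \<open>comb_seq\<close>.\<close>

interpretation srw: sequence_space "measure_pmf (pmf_of_set unit_steps)"
  rewrites "PiM (UNIV :: nat set) (\<lambda>_. measure_pmf (pmf_of_set unit_steps)) = srw_increments"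
  by unfold_locales (simp add: srw_increments_def)

lemma srw_prefix_sets: "{a \<in> space srw_increments. \<forall>i<n. a i = s i} \<in> sets srw_increments"
  unfolding srw_increments_def by measurable

lemma prob_srw_prefix:
  fixes s :: "nat \<Rightarrow> int ^ 'd::finite"
  assumes "\<And>i. i < n \<Longrightarrow> s i \<in> unit_steps"
  shows "(1 / (2 * real CARD('d))) ^ n \<le> measure srw_increments {a \<in> space srw_increments. \<forall>i<n. a i = s i}"
proof -
  have "emeasure srw_increments {a \<in> space srw_increments. \<forall>i<n. a i = s i} =
      (\<Prod>i\<in>{..<n}. emeasure (measure_pmf (pmf_of_set unit_steps)) {s i})"
    using srw.emeasure_PiM_Collect[of "{..<n}" "\<lambda>i. {s i}"] by (simp add: Ball_def)
  also have "\<dots> = (\<Prod>i\<in>{..<n}. ennreal (1 / real (card (unit_steps :: (int ^ 'd) set))))"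
    using assms by (intro prod.cong) (auto simp: emeasure_pmf_single)
  also have "\<dots> = ennreal ((1 / real (card (unit_steps :: (int ^ 'd) set))) ^ n)"
    by (simp add: ennreal_power)
  finally have "measure srw_increments {a \<in> space srw_increments. \<forall>i<n. a i = s i} =
      (1 / real (card (unit_steps :: (int ^ 'd) set))) ^ n"
    by (simp add: measure_def)
  moreover have "1 / (2 * real CARD('d)) \<le> 1 / real (card (unit_steps :: (int ^ 'd) set))"
  proof (rule divide_left_mono)
    show "real (card (unit_steps :: (int ^ 'd) set)) \<le> 2 * real CARD('d)"
      using card_unit_steps[where 'd = 'd] by linarith
    show "0 < 2 * real CARD('d) * real (card (unit_steps :: (int ^ 'd) set))"
      by (simp add: card_gt_0_iff)
  qed simp
  ultimately show ?thesis by (simp add: power_mono)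
qed

text \<open>If no run of length \<open>k\<close> occurs anywhere, then the first \<open>k\<close>
  steps are not a run and the sequence shifted by \<open>k\<close> has no run either. With
  \<open>A\<close> and \<open>C\<close> as in the proof, independence gives P(A) \<le> P(C) * P(A)
  with P(C) < 1, hence P(A) = 0.\<close>

lemma AE_srw_has_run:
  fixes e :: "int ^ 'd::finite"
  assumes e: "e \<in> unit_steps"
  shows "AE a in srw_increments. \<exists>n. \<forall>i<k. a (n + i) = e"
proof -
  let ?S = "srw_increments :: (nat \<Rightarrow> int ^ 'd) measure"
  define A where "A = {a \<in> space ?S. \<forall>n. \<exists>i<k. a (n + i) \<noteq> e}"
  define C where "C = {a \<in> space ?S. \<exists>i<k. a i \<noteq> e}"
  have A [measurable]: "A \<in> sets ?S" unfolding A_def srw_increments_def by measurable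
  have C [measurable]: "C \<in> sets ?S" unfolding C_def srw_increments_def by measurable
  have "space ?S - C = {a \<in> space ?S. \<forall>i<k. a i = e}" by (auto simp: C_def)
  moreover have "0 < (1 / (2 * real CARD('d))) ^ k" by simp
  ultimately have "0 < measure ?S (space ?S - C)"
    using prob_srw_prefix[of k "\<lambda>_. e"] e by (metis less_le_trans)
  hence C1: "measure ?S C < 1" using srw.prob_compl[OF C] by simp
  have "emeasure ?S A = emeasure (distr (?S \<Otimes>\<^sub>M ?S) ?S (\<lambda>(a, b). comb_seq k a b)) A"
    by (simp only: srw.PiM_comb_seq)
  also have "\<dots> = emeasure (?S \<Otimes>\<^sub>M ?S) ((\<lambda>(a, b). comb_seq k a b) -` A \<inter> space (?S \<Otimes>\<^sub>M ?S))"
    using measurable_comb_seq[of k "measure_pmf (pmf_of_set unit_steps)"]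
    by (intro emeasure_distr) (simp_all add: srw_increments_def[symmetric])
  also have "\<dots> \<le> emeasure (?S \<Otimes>\<^sub>M ?S) (C \<times> A)"
  proof (rule emeasure_mono)
    show "(\<lambda>(a, b). comb_seq k a b) -` A \<inter> space (?S \<Otimes>\<^sub>M ?S) \<subseteq> C \<times> A"
    proof safe
      fix a b assume ab: "(a, b) \<in> space (?S \<Otimes>\<^sub>M ?S)" "comb_seq k a b \<in> A"
      hence *: "\<exists>i<k. comb_seq k a b (n + i) \<noteq> e" for n by (simp add: A_def)
      from *[of 0] ab show "a \<in> C" by (auto simp: C_def comb_seq_less space_pair_measure)
      have "comb_seq k a b (n + k + i) = b (n + i)" for n i
        using comb_seq_add[of k a b "n + i"] by (simp add: ac_simps)
      hence "\<exists>i<k. b (n + i) \<noteq> e" for n using *[of "n + k"] by simp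
      thus "b \<in> A" using ab by (auto simp: A_def space_pair_measure)
    qed
  qed measurable
  also have "\<dots> = emeasure ?S C * emeasure ?S A"
    by (rule srw.emeasure_pair_measure_Times) measurable
  finally have "measure ?S A \<le> measure ?S C * measure ?S A"
    by (simp add: srw.emeasure_eq_measure ennreal_mult[symmetric])
  hence "measure ?S A * (1 - measure ?S C) \<le> 0" by (simp add: algebra_simps)
  hence "measure ?S A = 0" using C1 by (simp add: mult_le_0_iff measure_le_0_iff)
  hence "A \<in> null_sets ?S" using A by (simp add: null_sets_def srw.emeasure_eq_measure)
  thus ?thesis by (rule AE_I') (auto simp: A_def)
qed

text \<open>A run of k equal steps visits k + 1 distinct sites, and runs of every length occur. This
  works in every dimension, regardless of recurrence.\<close>

lemma AE_srw_infinite_range: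
  "AE a in (srw_increments :: (nat \<Rightarrow> int ^ 'd::finite) measure). infinite (range (\<lambda>n. \<Sum>i<n. a i))"
proof -
  let ?e = "axis undefined 1 :: int ^ 'd"
  have "AE a in srw_increments. \<forall>k. \<exists>n. \<forall>i<k. a (n + i) = ?e"
    unfolding AE_all_countable by (intro allI AE_srw_has_run axis_in_unit_steps)
  thus ?thesis
  proof eventually_elim
    case (elim a)
    show ?case
    proof
      let ?p = "\<lambda>n. \<Sum>i<n. a i"
      assume fin: "finite (range ?p)"
      obtain n where n: "\<And>i. i < card (range ?p) \<Longrightarrow> a (n + i) = ?e" using elim by blast
      have shift: "?p (n + j) $ undefined = ?p n $ undefined + int j" if "j \<le> card (range ?p)" for j
        using that by (induction j) (simp_all add: n axis_def)
      have "inj_on (\<lambda>j. ?p (n + j)) {..card (range ?p)}"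
      proof (rule inj_onI)
        fix i j assume "i \<in> {..card (range ?p)}" "j \<in> {..card (range ?p)}" "?p (n + i) = ?p (n + j)"
        thus "i = j" using shift[of i] shift[of j] by simp
      qed
      moreover have "(\<lambda>j. ?p (n + j)) ` {..card (range ?p)} \<subseteq> range ?p" by blast
      ultimately have "card {..card (range ?p)} \<le> card (range ?p)"
        using fin by (rule card_inj_on_le)
      thus False by simp
    qed
  qed
qed

section \<open>Rich sites and followed geodesics\<close>

lemma sets_PiM_all:
  assumes "finite J" "J \<subseteq> I" "B \<in> sets M"
  shows "{x \<in> space (PiM I (\<lambda>_. M)). \<forall>i\<in>J. x i \<in> B} \<in> sets (PiM I (\<lambda>_. M))"
  by (rule sets.sets_Collect_finite_All[OF sets_Collect_single]) (use assms in auto)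

text \<open>The failure bound at scale m is a product of three factors: the number of candidates
  \<open>x\<close>, at most m ^ d; the number of cubes in the window of one candidate; and the
  probability that a cube contains no rich site.\<close>

lemma AE_good_site:
  fixes \<mu> :: "nat pmf" and Z :: "(int ^ 'd::finite) set"
  assumes Z: "infinite Z"
    and summ: "summable (\<lambda>m. real m ^ CARD('d) * (2 * real m ^ 4 + 1) ^ CARD('d) * measure_pmf.prob \<mu> {..<L m} ^ (m ^ CARD('d)))"
  shows "AE \<omega> in PiM (UNIV :: (int ^ 'd) set) (\<lambda>_. measure_pmf \<mu>). \<forall>K0. \<exists>K\<ge>K0. \<exists>x\<in>Z. good_site L \<omega> x K"
  unfolding AE_all_countable
proof
  fix K0 :: nat
  let ?d = "CARD('d)"
  let ?M = "PiM (UNIV :: (int ^ 'd) set) (\<lambda>_. measure_pmf \<mu>)"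
  define r where "r m = measure_pmf.prob \<mu> {..<L m}" for m
  define f where "f m = real m ^ ?d * (2 * real m ^ 4 + 1) ^ ?d * r m ^ (m ^ ?d)" for m
  have f0: "0 \<le> f m" for m by (simp add: f_def r_def)
  define Poor where "Poor V m = {\<omega> \<in> space ?M. \<forall>v\<in>V. \<omega> v \<in> {..<L m}}" for V m
  have Poor_le: "emeasure ?M (Poor V m) \<le> ennreal (r m ^ (m ^ ?d))" if "finite V" "card V = m ^ ?d" for V m
    unfolding Poor_def
    by (rule emeasure_PiM_all_le) (use that in \<open>auto simp: r_def measure_pmf.prob_space_axioms\<close>)
  have Poor_sets [measurable]: "Poor V m \<in> sets ?M" if "finite V" for V m
    unfolding Poor_def using that by (intro sets_PiM_all) auto
  show "AE \<omega> in ?M. \<exists>K\<ge>K0. \<exists>x\<in>Z. good_site L \<omega> x K"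
  proof (rule AE_of_summable_covers[where f = "\<lambda>m. 2 * f m"])
    show "summable (\<lambda>m. 2 * f m)" using summ by (intro summable_mult) (simp add: f_def r_def)
    show "0 \<le> 2 * f m" for m using f0[of m] by simp
    fix K1 :: nat
    \<comment> \<open>\<open>K\<close> is at least 1, so that the counting factors in
      \<open>f\<close> are at least 1 and \<open>f\<close> also dominates the probability that
      \<open>V\<close> contains no rich site.\<close>
    define K where "K = Max {1, K0, K1}"
    have K: "1 \<le> K" "K0 \<le> K" "K1 \<le> K" by (auto simp: K_def)
    obtain V where V: "V \<subseteq> Z" "finite V" "card V = K ^ ?d"
      using infinite_arbitrarily_large[OF Z] by metis
    \<comment> \<open>Which site of \<open>V\<close> is rich depends on the configuration, so the
      cubes around all of them are controlled. That \<open>V\<close> itself lacks a rich site counts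
      as a failure once, at the starting scale.\<close>
    define A where "A m = (if m = K then Poor V K else {}) \<union>
      (\<Union>x\<in>V. \<Union>y\<in>{y. l1norm (y - x) \<le> m ^ 4}. Poor (cube y m) m)" for m
    have A_sets: "A m \<in> sets ?M" for m
      unfolding A_def using V(2) by (intro sets.Un sets.finite_UN) (auto intro: Poor_sets)
    have A_le: "emeasure ?M (A m) \<le> ennreal (2 * f m)" if m: "K \<le> m" for m
    proof -
      have "emeasure ?M (A m) \<le> emeasure ?M (if m = K then Poor V K else {}) +
          emeasure ?M (\<Union>x\<in>V. \<Union>y\<in>{y. l1norm (y - x) \<le> m ^ 4}. Poor (cube y m) m)"
        unfolding A_def using V(2)
        by (intro emeasure_subadditive sets.finite_UN) (auto intro: Poor_sets)
      also have "\<dots> \<le> ennreal (f m) + ennreal (f m)"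
      proof (rule add_mono)
        have "r m ^ (m ^ ?d) \<le> f m"
        proof -
          have "1 \<le> real m ^ ?d" using m K(1) by (intro one_le_power) simp
          moreover have "1 \<le> (2 * real m ^ 4 + 1) ^ ?d" by (intro one_le_power) simp
          ultimately have "1 * 1 \<le> real m ^ ?d * (2 * real m ^ 4 + 1) ^ ?d" by (intro mult_mono) auto
          hence "1 * r m ^ (m ^ ?d) \<le> f m" unfolding f_def by (intro mult_right_mono) (auto simp: r_def)
          thus ?thesis by simp
        qed
        thus "emeasure ?M (if m = K then Poor V K else {}) \<le> ennreal (f m)"
          using Poor_le[OF V(2,3)] by (auto intro: order_trans ennreal_leI)
        have "emeasure ?M (\<Union>y\<in>{y. l1norm (y - x) \<le> m ^ 4}. Poor (cube y m) m) \<le>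
            ennreal ((2 * real m ^ 4 + 1) ^ ?d * r m ^ (m ^ ?d))" for x :: "int ^ 'd"
        proof -
          let ?B = "{y. l1norm (y - x) \<le> m ^ 4}"
          have "emeasure ?M (\<Union>y\<in>?B. Poor (cube y m) m) \<le> (\<Sum>y\<in>?B. emeasure ?M (Poor (cube y m) m))"
            by (rule emeasure_subadditive_finite) (auto intro: Poor_sets)
          also have "\<dots> \<le> (\<Sum>y\<in>?B. ennreal (r m ^ (m ^ ?d)))"
            by (intro sum_mono Poor_le) (simp_all add: card_cube)
          also have "\<dots> = ennreal (real (card ?B) * r m ^ (m ^ ?d))"
            by (simp add: r_def ennreal_mult ennreal_of_nat_eq_real_of_nat)
          also have "\<dots> \<le> ennreal ((2 * real m ^ 4 + 1) ^ ?d * r m ^ (m ^ ?d))"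
          proof (intro ennreal_leI mult_right_mono)
            have "real (card ?B) \<le> real ((2 * m ^ 4 + 1) ^ ?d)" using card_l1ball[of x "m ^ 4"] by (rule of_nat_mono)
            thus "real (card ?B) \<le> (2 * real m ^ 4 + 1) ^ ?d" by (simp add: add.commute)
          qed (simp add: r_def)
          finally show ?thesis .
        qed
        note ball_le = this
        have "emeasure ?M (\<Union>x\<in>V. \<Union>y\<in>{y. l1norm (y - x) \<le> m ^ 4}. Poor (cube y m) m) \<le>
            (\<Sum>x\<in>V. emeasure ?M (\<Union>y\<in>{y. l1norm (y - x) \<le> m ^ 4}. Poor (cube y m) m))"
          using V(2) by (intro emeasure_subadditive_finite) (auto intro!: sets.finite_UN Poor_sets)
        also have "\<dots> \<le> (\<Sum>x\<in>V. ennreal ((2 * real m ^ 4 + 1) ^ ?d * r m ^ (m ^ ?d)))"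
          by (intro sum_mono ball_le)
        also have "\<dots> = ennreal (real K ^ ?d * ((2 * real m ^ 4 + 1) ^ ?d * r m ^ (m ^ ?d)))"
          by (simp add: V(3) r_def ennreal_mult ennreal_of_nat_eq_real_of_nat)
        also have "\<dots> \<le> ennreal (f m)"
        proof (rule ennreal_leI)
          have "real K ^ ?d \<le> real m ^ ?d" using m by (intro power_mono) auto
          hence "real K ^ ?d * ((2 * real m ^ 4 + 1) ^ ?d * r m ^ (m ^ ?d)) \<le>
              real m ^ ?d * ((2 * real m ^ 4 + 1) ^ ?d * r m ^ (m ^ ?d))"
            by (rule mult_right_mono) (simp add: r_def)
          thus "real K ^ ?d * ((2 * real m ^ 4 + 1) ^ ?d * r m ^ (m ^ ?d)) \<le> f m"
            by (simp only: f_def mult.assoc)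
        qed
        finally show "emeasure ?M (\<Union>x\<in>V. \<Union>y\<in>{y. l1norm (y - x) \<le> m ^ 4}. Poor (cube y m) m) \<le> ennreal (f m)" .
      qed
      also have "\<dots> = ennreal (2 * f m)" using f0[of m] by (simp flip: ennreal_plus)
      finally show ?thesis .
    qed
    have good: "\<exists>K\<ge>K0. \<exists>x\<in>Z. good_site L \<omega> x K" if \<omega>: "\<omega> \<in> space ?M" "\<forall>m\<ge>K. \<omega> \<notin> A m" for \<omega>
    proof -
      have "\<omega> \<notin> Poor V K" using \<omega>(2) by (auto simp: A_def)
      then obtain x where x: "x \<in> V" "L K \<le> \<omega> x" using \<omega>(1) by (auto simp: Poor_def not_less)
      have "\<exists>v\<in>cube y m. L m \<le> \<omega> v" if "K \<le> m" "l1norm (y - x) \<le> m ^ 4" for m y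
      proof -
        have "\<omega> \<notin> Poor (cube y m) m" using \<omega>(2) that x(1) unfolding A_def by blast
        thus ?thesis using \<omega>(1) by (auto simp: Poor_def not_less)
      qed
      hence "good_site L \<omega> x K" using x(2) unfolding good_site_def by blast
      thus ?thesis using x(1) V(1) K(2) by blast
    qed
    show "\<exists>K\<ge>K1. \<exists>A. (\<forall>m\<ge>K. A m \<in> sets ?M \<and> emeasure ?M (A m) \<le> ennreal (2 * f m)) \<and>
      (\<forall>\<omega>\<in>space ?M. (\<forall>m\<ge>K. \<omega> \<notin> A m) \<longrightarrow> (\<exists>K\<ge>K0. \<exists>x\<in>Z. good_site L \<omega> x K))"
      by (rule exI[of _ K], rule conjI[OF K(3)], rule exI[of _ A]) (use A_sets A_le good in blast)
  qed
qed

lemma measurable_partial_sum [measurable]: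
  "(\<lambda>a. \<Sum>i<n. a i) \<in> measurable (srw_increments :: (nat \<Rightarrow> int ^ 'd::finite) measure) (count_space UNIV)"
proof (induction n)
  case (Suc n)
  have nth: "(\<lambda>a. a n) \<in> measurable (srw_increments :: (nat \<Rightarrow> int ^ 'd) measure) (count_space UNIV)"
    unfolding srw_increments_def by measurable
  have "(\<lambda>a. v + a n) \<in> measurable srw_increments (count_space UNIV)" for v :: "int ^ 'd"
    by (rule measurable_compose[OF nth]) simp
  from measurable_compose_countable[where f = "\<lambda>v a. v + a n", OF this Suc] show ?case by simp
qed simp

text \<open>Fubini: for a fixed walk with infinite range almost every configuration is good, and the
  order of the two quantifiers is exchanged to obtain a statement for fixed configurations.\<close>

lemma AE_AE_good_site:
  fixes \<mu> :: "nat pmf"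
  assumes summ: "summable (\<lambda>m. real m ^ CARD('d) * (2 * real m ^ 4 + 1) ^ CARD('d) * measure_pmf.prob \<mu> {..<L m} ^ (m ^ CARD('d)))"
  shows "AE \<omega> in PiM (UNIV :: (int ^ 'd::finite) set) (\<lambda>_. measure_pmf \<mu>). AE a in srw_increments.
    \<forall>K0. \<exists>K\<ge>K0. \<exists>x\<in>range (\<lambda>n. \<Sum>i<n. a i). good_site L \<omega> x K"
proof -
  let ?M = "PiM (UNIV :: (int ^ 'd) set) (\<lambda>_. measure_pmf \<mu>)"
  let ?S = "srw_increments :: (nat \<Rightarrow> int ^ 'd) measure"
  interpret M: product_prob_space "\<lambda>_. measure_pmf \<mu>" "UNIV :: (int ^ 'd) set" by unfold_locales
  interpret pair: pair_sigma_finite ?M ?S by unfold_locales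
  have [measurable]: "Measurable.pred ?M (\<lambda>\<omega>. good_site L \<omega> x K)" for x K
    unfolding good_site_def by measurable
  \<comment> \<open>The range depends on the walk; quantifying over the countable types of sites and
    times instead exhibits the event as measurable on the product space.\<close>
  have *: "(\<exists>x\<in>range (\<lambda>n. \<Sum>i<n. a i). good_site L \<omega> x K) \<longleftrightarrow> (\<exists>x n. (\<Sum>i<n. a i) = x \<and> good_site L \<omega> x K)"
    for a :: "nat \<Rightarrow> int ^ 'd" and \<omega> K by blast
  have "AE a in ?S. AE \<omega> in ?M. \<forall>K0. \<exists>K\<ge>K0. \<exists>x\<in>range (\<lambda>n. \<Sum>i<n. a i). good_site L \<omega> x K"
    using AE_srw_infinite_range by eventually_elim (rule AE_good_site[OF _ summ])
  thus ?thesis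
    unfolding * by (subst pair.AE_commute) measurable
qed

text \<open>
  Particle number \<open>1\<close> is excluded, so that this event does not involve the walk of the first
  particle at the origin.
\<close>

definition followed_around :: "(nat \<Rightarrow> nat) \<Rightarrow> (nat \<Rightarrow> nat) \<Rightarrow> (int ^ 'd::finite \<Rightarrow> nat) \<Rightarrow> ((int ^ 'd) \<times> nat \<Rightarrow> nat \<Rightarrow> int ^ 'd)
    \<Rightarrow> int ^ 'd \<Rightarrow> nat \<Rightarrow> bool" where
  "followed_around L g \<omega> w x K \<longleftrightarrow>
     (\<forall>m\<ge>K. \<forall>y. l1norm (y - x) \<le> m ^ 4 \<longrightarrow> L m \<le> \<omega> y \<longrightarrow>
        (\<forall>z. l1norm (z - y) \<le> m * g m \<longrightarrow>
          (\<exists>k\<in>{2..\<omega> y}. \<forall>i<l1norm (z - y). w (y, k) i = geodesic (z - y) i)))"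

lemma followed_around_imp_fast_around:
  assumes "followed_around L g \<omega> w x K"
  shows "fast_around L g \<omega> w x K"
  unfolding fast_around_def
proof (intro allI impI)
  fix m y z
  assume "K \<le> m" "l1norm (y - x) \<le> m ^ 4" "L m \<le> \<omega> y" "l1norm (z - y) \<le> m * g m"
  then obtain k where k: "k \<in> {2..\<omega> y}" "\<forall>i<l1norm (z - y). w (y, k) i = geodesic (z - y) i"
    using assms unfolding followed_around_def by blast
  have "walk w y k (l1norm (z - y)) = y + (\<Sum>i<l1norm (z - y). geodesic (z - y) i)"
    unfolding walk_def using k(2) by simp
  hence "walk w y k (l1norm (z - y)) = z" by (simp add: geodesic(2))
  hence "frog_t \<omega> w y z \<le> enat (l1norm (z - y))" using k(1) by (intro frog_t_le[of k]) auto
  thus "frog_T \<omega> w y z \<le> enat (l1norm (z - y))" by (rule order_trans[OF frog_T_le_frog_t])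
qed

text \<open>This invariance is what lets the first walk be replaced by an independent copy without
  affecting the event on the others.\<close>

lemma followed_around_fun_upd:
  "followed_around L g \<omega> (w((y, 1) := a)) x K \<longleftrightarrow> followed_around L g \<omega> w x K"
proof -
  have "(w((y, 1) := a)) (y', k) = w (y', k)" if "k \<in> {2..\<omega> y'}" for k y'
    using that by auto
  thus ?thesis unfolding followed_around_def by simp
qed

lemma measurable_followed_around [measurable]:
  "Measurable.pred (walk_space \<omega>) (\<lambda>w. followed_around L g \<omega> w x K)"
proof -
  \<comment> \<open>Only walks of existing particles are coordinates of
    \<open>walk_space \<omega>\<close>, whence the condition on \<open>k\<close>.\<close>
  have comp: "Measurable.pred (walk_space \<omega>) (\<lambda>w. \<forall>i<n. w (y, k) i = s i)" if "k \<in> {2..\<omega> y}" for y k n s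
  proof -
    have "(\<lambda>w. w (y, k)) \<in> measurable (walk_space \<omega>) srw_increments"
      unfolding walk_space_def using that by (intro measurable_component_singleton) auto
    have "Measurable.pred srw_increments (\<lambda>a. \<forall>i<n. a i = s i)"
      unfolding pred_def by (rule srw_prefix_sets)
    thus ?thesis by (rule measurable_compose[rotated]) fact
  qed
  show ?thesis
    unfolding followed_around_def
    by (intro pred_intros_countable pred_intros_imp' pred_intros_finite comp) auto
qed

text \<open>Configuration and \<open>Z\<close> are fixed here, so for each scale \<open>K\<close> a
  single site \<open>x\<close> can be selected before any walk is drawn. The union bound then runs
  over rich sites \<open>y\<close> in the window and targets \<open>z\<close> in reach; a target is
  missed only if at least L m - 1 independent particles all deviate from its geodesic.\<close>

lemma AE_followed_around:
  fixes \<omega> :: "int ^ 'd::finite \<Rightarrow> nat"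
  assumes good: "\<And>K0. \<exists>K\<ge>K0. \<exists>x\<in>Z. good_site L \<omega> x K"
    and summ: "summable (\<lambda>m. (2 * real m ^ 4 + 1) ^ CARD('d) * (2 * (real m * real (g m)) + 1) ^ CARD('d) *
      (1 - (1 / (2 * real CARD('d))) ^ (m * g m)) ^ (L m - 1))"
  shows "AE w in walk_space \<omega>. \<exists>K\<ge>K0. \<exists>x\<in>Z. good_site L \<omega> x K \<and> followed_around L g \<omega> w x K"
proof -
  let ?d = "CARD('d)"
  let ?W = "walk_space \<omega>"
  let ?S = "srw_increments :: (nat \<Rightarrow> int ^ 'd) measure"
  \<comment> \<open>A lower bound for the probability of one prescribed step.\<close>
  define p where "p = 1 / (2 * real ?d)"
  have "1 \<le> real ?d" by (simp add: Suc_le_eq)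
  hence "1 \<le> 2 * real ?d" by linarith
  hence p: "0 < p" "p \<le> 1" unfolding p_def by (simp, subst divide_le_eq_1_pos) auto
  have pn: "0 \<le> 1 - p ^ n" "1 - p ^ n \<le> 1" for n using p by (auto simp: power_le_one)
  define f where "f m = (2 * real m ^ 4 + 1) ^ ?d * (2 * (real m * real (g m)) + 1) ^ ?d * (1 - p ^ (m * g m)) ^ (L m - 1)" for m
  define Miss where "Miss y z = {w \<in> space ?W. \<forall>i\<in>Pair y ` {2..\<omega> y}.
    w i \<in> {a \<in> space ?S. \<not> (\<forall>j<l1norm (z - y). a j = geodesic (z - y) j)}}" for y z
  have miss_S: "{a \<in> space ?S. \<not> (\<forall>j<n. a j = s j)} \<in> sets ?S" for n s
    unfolding srw_increments_def by measurable
  have Miss_sets: "Miss y z \<in> sets ?W" for y z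
    unfolding Miss_def walk_space_def by (intro sets_PiM_all miss_S) auto
  have Miss_le: "emeasure ?W (Miss y z) \<le> ennreal ((1 - p ^ (m * g m)) ^ (L m - 1))"
    if "L m \<le> \<omega> y" "l1norm (z - y) \<le> m * g m" for y z m
    unfolding Miss_def walk_space_def
  proof (rule emeasure_PiM_all_le)
    show "prob_space ?S" by (rule srw.prob_space_axioms)
    show "Pair y ` {2..\<omega> y} \<subseteq> {(x, k). 1 \<le> k \<and> k \<le> \<omega> x}" by auto
    show "L m - 1 \<le> card (Pair y ` {2..\<omega> y})"
      using that(1) by (subst card_image) (auto simp: inj_on_def)
    show "0 \<le> 1 - p ^ (m * g m)" "1 - p ^ (m * g m) \<le> 1" by (rule pn)+
    let ?F = "{a \<in> space ?S. \<forall>j<l1norm (z - y). a j = geodesic (z - y) j}"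
    have "{a \<in> space ?S. \<not> (\<forall>j<l1norm (z - y). a j = geodesic (z - y) j)} = space ?S - ?F" by auto
    moreover have "measure ?S (space ?S - ?F) = 1 - measure ?S ?F"
      by (rule srw.prob_compl) (rule srw_prefix_sets)
    moreover have "p ^ l1norm (z - y) \<le> measure ?S ?F"
      unfolding p_def by (rule prob_srw_prefix) (rule geodesic(1))
    moreover have "p ^ (m * g m) \<le> p ^ l1norm (z - y)"
      using p that(2) by (intro power_decreasing) auto
    ultimately show "measure ?S {a \<in> space ?S. \<not> (\<forall>j<l1norm (z - y). a j = geodesic (z - y) j)} \<le> 1 - p ^ (m * g m)"
      by simp
  qed (simp, rule miss_S)
  show ?thesis
  proof (rule AE_of_summable_covers[where f = f])
    show "summable f" using summ by (simp add: f_def[abs_def] p_def)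
    show "0 \<le> f m" for m using pn(1) by (auto simp: f_def)
    fix K1 :: nat
    obtain K x where K: "max K0 K1 \<le> K" "x \<in> Z" "good_site L \<omega> x K" using good by blast
    let ?B = "\<lambda>m. {y. l1norm (y - x) \<le> m ^ 4} \<inter> {y. L m \<le> \<omega> y}"
    let ?C = "\<lambda>y m. {z. l1norm (z - y) \<le> m * g m}"
    define A where "A m = (\<Union>y\<in>?B m. \<Union>z\<in>?C y m. Miss y z)" for m
    have A_sets: "A m \<in> sets ?W" for m
      unfolding A_def by (intro sets.finite_UN Miss_sets) auto
    have A_le: "emeasure ?W (A m) \<le> ennreal (f m)" for m
    proof -
      let ?q = "(1 - p ^ (m * g m)) ^ (L m - 1)"
      let ?c = "(2 * (real m * real (g m)) + 1) ^ ?d"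
      have q0: "0 \<le> ?q" using pn(1) by simp
      have C_le: "emeasure ?W (\<Union>z\<in>?C y m. Miss y z) \<le> ennreal (?c * ?q)" if "y \<in> ?B m" for y
      proof -
        have "emeasure ?W (\<Union>z\<in>?C y m. Miss y z) \<le> (\<Sum>z\<in>?C y m. emeasure ?W (Miss y z))"
          by (rule emeasure_subadditive_finite) (auto intro: Miss_sets)
        also have "\<dots> \<le> (\<Sum>z\<in>?C y m. ennreal ?q)"
          using that by (intro sum_mono Miss_le) auto
        also have "\<dots> = ennreal (real (card (?C y m)) * ?q)"
          using q0 by (simp add: ennreal_mult ennreal_of_nat_eq_real_of_nat)
        also have "\<dots> \<le> ennreal (?c * ?q)"
        proof (intro ennreal_leI mult_right_mono q0)
          have "real (card (?C y m)) \<le> real ((2 * (m * g m) + 1) ^ ?d)"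
            using card_l1ball[of y "m * g m"] by (rule of_nat_mono)
          thus "real (card (?C y m)) \<le> ?c" by (simp add: add.commute)
        qed
        finally show ?thesis .
      qed
      have "emeasure ?W (A m) \<le> (\<Sum>y\<in>?B m. emeasure ?W (\<Union>z\<in>?C y m. Miss y z))"
        unfolding A_def by (rule emeasure_subadditive_finite) (auto intro!: sets.finite_UN Miss_sets)
      also have "\<dots> \<le> (\<Sum>y\<in>?B m. ennreal (?c * ?q))" by (intro sum_mono C_le)
      also have "\<dots> = ennreal (real (card (?B m)) * (?c * ?q))"
        using q0 by (simp add: ennreal_mult ennreal_of_nat_eq_real_of_nat)
      also have "\<dots> \<le> ennreal ((2 * real m ^ 4 + 1) ^ ?d * (?c * ?q))"
      proof (intro ennreal_leI mult_right_mono)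
        have "card (?B m) \<le> card {y. l1norm (y - x) \<le> m ^ 4}" by (intro card_mono) auto
        also have "\<dots> \<le> (2 * m ^ 4 + 1) ^ ?d" by (rule card_l1ball)
        finally have "real (card (?B m)) \<le> real ((2 * m ^ 4 + 1) ^ ?d)" by (rule of_nat_mono)
        thus "real (card (?B m)) \<le> (2 * real m ^ 4 + 1) ^ ?d" by (simp add: add.commute)
      qed (use q0 in auto)
      also have "(2 * real m ^ 4 + 1) ^ ?d * (?c * ?q) = f m" by (simp only: f_def mult.assoc)
      finally show ?thesis .
    qed
    have foll: "followed_around L g \<omega> w x K" if w: "w \<in> space ?W" "\<forall>m\<ge>K. w \<notin> A m" for w
      unfolding followed_around_def
    proof (intro allI impI)
      fix m y z
      assume H: "K \<le> m" "l1norm (y - x) \<le> m ^ 4" "L m \<le> \<omega> y" "l1norm (z - y) \<le> m * g m"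
      hence "w \<notin> Miss y z" using w(2) unfolding A_def by blast
      then obtain k where k: "k \<in> {2..\<omega> y}"
        "w (y, k) \<notin> {a \<in> space ?S. \<not> (\<forall>j<l1norm (z - y). a j = geodesic (z - y) j)}"
        using w(1) unfolding Miss_def by blast
      moreover have "w (y, k) \<in> space ?S"
        using w(1) k(1) by (auto simp: walk_space_def space_PiM PiE_iff)
      ultimately show "\<exists>k\<in>{2..\<omega> y}. \<forall>i<l1norm (z - y). w (y, k) i = geodesic (z - y) i" by blast
    qed
    show "\<exists>K\<ge>K1. \<exists>A. (\<forall>m\<ge>K. A m \<in> sets ?W \<and> emeasure ?W (A m) \<le> ennreal (f m)) \<and>
        (\<forall>w\<in>space ?W. (\<forall>m\<ge>K. w \<notin> A m) \<longrightarrow>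
          (\<exists>K\<ge>K0. \<exists>x\<in>Z. good_site L \<omega> x K \<and> followed_around L g \<omega> w x K))"
    proof (rule exI[of _ K], rule conjI, use K(1) in simp, rule exI[of _ A], rule conjI)
      show "\<forall>m\<ge>K. A m \<in> sets ?W \<and> emeasure ?W (A m) \<le> ennreal (f m)" using A_sets A_le by blast
      show "\<forall>w\<in>space ?W. (\<forall>m\<ge>K. w \<notin> A m) \<longrightarrow>
          (\<exists>K\<ge>K0. \<exists>x\<in>Z. good_site L \<omega> x K \<and> followed_around L g \<omega> w x K)"
        using foll K by (meson max.boundedE)
    qed
  qed
qed

section \<open>Summability of the failure probabilities\<close>

lemma one_minus_power_le_exp:
  assumes "0 \<le> x" "x \<le> (1::real)"
  shows "(1 - x) ^ n \<le> exp (- (x * real n))"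
proof -
  have "(1 - x) ^ n \<le> exp (- x) ^ n"
    using assms exp_ge_add_one_self[of "- x"] by (intro power_mono) auto
  thus ?thesis by (simp add: exp_of_nat_mult[symmetric] mult.commute)
qed

text \<open>Since ln (L m) is at most 2 * m powr \<alpha>, a site is rich with probability at least
  a constant times m powr (- \<alpha> * \<delta>). A cube has m ^ D sites, so it lacks a rich one
  with stretched exponentially small probability, which beats the polynomial factors.\<close>

lemma summable_poor_cubes:
  fixes \<mu> :: "nat pmf" and D :: nat
  assumes \<delta>: "0 < \<delta>" and tail: "eventually (\<lambda>n. measure_pmf.prob \<mu> {n..} \<ge> ln (real n) powr (- \<delta>)) sequentially"
    and \<alpha>: "0 < \<alpha>" "\<alpha> * \<delta> < real D"
  defines "L \<equiv> \<lambda>m. nat \<lceil>exp (real m powr \<alpha>)\<rceil>"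
  shows "summable (\<lambda>m. real m ^ D * (2 * real m ^ 4 + 1) ^ D * measure_pmf.prob \<mu> {..<L m} ^ (m ^ D))"
proof (rule summable_comparison_test_ev)
  \<comment> \<open>The constant comes from ln (L m) \<le> 2 * m powr \<alpha>, where the 2 absorbs
    the rounding up in \<open>L\<close>.\<close>
  define c where "c = 2 powr (- \<delta>)"
  define \<gamma> where "\<gamma> = real D - \<alpha> * \<delta>"
  have c: "0 < c" and \<gamma>: "0 < \<gamma>" using \<alpha> by (simp_all add: c_def \<gamma>_def)
  have "filterlim L at_top sequentially" unfolding L_def using \<alpha>(1) by real_asymp
  from eventually_compose_filterlim[OF tail this]
  have ev1: "eventually (\<lambda>m. ln (real (L m)) powr (- \<delta>) \<le> measure_pmf.prob \<mu> {L m..}) sequentially" .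
  have "eventually (\<lambda>m. real m ^ D * (2 * real m ^ 4 + 1) ^ D * exp (- (c * real m powr \<gamma>)) \<le> 1 / real m ^ 2) sequentially"
  proof -
    have "((\<lambda>m. (real m * (2 * real m ^ 4 + 1)) powr real D * exp (- (c * real m powr \<gamma>)) * real m ^ 2) \<longlongrightarrow> 0) sequentially"
      using c \<gamma> by real_asymp
    hence "eventually (\<lambda>m. (real m * (2 * real m ^ 4 + 1)) powr real D * exp (- (c * real m powr \<gamma>)) * real m ^ 2 < 1) sequentially"
      by (rule order_tendstoD) simp
    with eventually_gt_at_top[of 0] show ?thesis
    proof eventually_elim
      case (elim m)
      have "0 < real m * (2 * real m ^ 4 + 1)" using elim(1) by (intro mult_pos_pos add_nonneg_pos) auto
      hence "(real m * (2 * real m ^ 4 + 1)) powr real D = real m ^ D * (2 * real m ^ 4 + 1) ^ D"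
        by (simp only: powr_realpow power_mult_distrib)
      with elim show ?case by (simp add: pos_le_divide_eq)
    qed
  qed
  thus "eventually (\<lambda>m. norm (real m ^ D * (2 * real m ^ 4 + 1) ^ D * measure_pmf.prob \<mu> {..<L m} ^ (m ^ D)) \<le> 1 / real m ^ 2) sequentially"
    using ev1 eventually_gt_at_top[of 0]
  proof eventually_elim
    case (elim m)
    let ?q = "measure_pmf.prob \<mu> {L m..}"
    let ?X = "real m powr \<alpha>"
    have X: "1 \<le> ?X" using elim(3) \<alpha>(1) by (intro ge_one_powr_ge_zero) auto
    have "exp 1 \<le> exp ?X" using X by simp
    hence L2: "2 \<le> exp ?X" using exp_ge_add_one_self[of 1] by linarith
    have "0 \<le> \<lceil>exp ?X\<rceil>" using exp_gt_zero[of ?X] by linarith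
    hence L_eq: "real (L m) = real_of_int \<lceil>exp ?X\<rceil>" unfolding L_def by (rule of_nat_nat)
    have L_le: "real (L m) \<le> exp ?X + 1" and L_ge: "exp ?X \<le> real (L m)" unfolding L_eq by linarith+
    have "exp ?X + 1 \<le> exp ?X * 2" using L2 by linarith
    also have "\<dots> \<le> exp ?X * exp 1" using exp_ge_add_one_self[of 1] by (intro mult_left_mono) auto
    finally have "real (L m) \<le> exp (?X + 1)" using L_le by (simp add: exp_add)
    hence "ln (real (L m)) \<le> ln (exp (?X + 1))" using L_ge L2 by (subst ln_le_cancel_iff) auto
    hence ln_le: "ln (real (L m)) \<le> 2 * ?X" using X unfolding ln_exp by linarith
    have ln_pos: "0 < ln (real (L m))" using L_ge L2 by simp
    have "c * real m powr (- (\<alpha> * \<delta>)) = (2 * ?X) powr (- \<delta>)"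
      by (simp add: c_def powr_mult powr_powr)
    also have "\<dots> \<le> ln (real (L m)) powr (- \<delta>)"
      using ln_le ln_pos \<delta> by (intro powr_mono2') auto
    also have "\<dots> \<le> ?q" using elim(2) .
    finally have q: "c * real m powr (- (\<alpha> * \<delta>)) \<le> ?q" .
    have "{..<L m} = UNIV - {L m..}" by auto
    hence "measure_pmf.prob \<mu> {..<L m} = 1 - ?q"
      using measure_pmf.prob_compl[of "{L m..}" \<mu>] by simp
    hence "measure_pmf.prob \<mu> {..<L m} ^ (m ^ D) \<le> exp (- (?q * real (m ^ D)))"
      using one_minus_power_le_exp[of ?q "m ^ D"] by simp
    also have "\<dots> \<le> exp (- (c * real m powr \<gamma>))"
    proof -
      have "real m powr \<gamma> = real m powr (- (\<alpha> * \<delta>)) * real (m ^ D)"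
        using elim(3) by (simp add: \<gamma>_def powr_realpow[symmetric] powr_add[symmetric])
      hence "c * real m powr \<gamma> = c * real m powr (- (\<alpha> * \<delta>)) * real (m ^ D)" by simp
      also have "\<dots> \<le> ?q * real (m ^ D)" using q by (rule mult_right_mono) simp
      finally show ?thesis by simp
    qed
    finally have "real m ^ D * (2 * real m ^ 4 + 1) ^ D * measure_pmf.prob \<mu> {..<L m} ^ (m ^ D) \<le>
        real m ^ D * (2 * real m ^ 4 + 1) ^ D * exp (- (c * real m powr \<gamma>))"
      by (rule mult_left_mono) simp
    with elim(1) show ?case by simp
  qed
qed (use inverse_power_summable[of 2, where 'a = real] in \<open>simp add: field_simps\<close>)

text \<open>A path of length m * g m, at most m powr (1 + \<beta>), is followed with probability at
  least p powr (m powr (1 + \<beta>)). The number of particles has the larger exponent 1 + 2 *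
  \<beta>, so the expected number of followers eventually exceeds m and all particles miss with
  probability at most exp (- m).\<close>

lemma summable_missed_targets:
  fixes \<beta> p :: real and D :: nat
  assumes \<beta>: "0 < \<beta>" and p: "0 < p" "p < 1"
  defines "L \<equiv> \<lambda>m. nat \<lceil>exp (real m powr (1 + 2 * \<beta>))\<rceil>" and "g \<equiv> \<lambda>m. nat \<lfloor>real m powr \<beta>\<rfloor>"
  shows "summable (\<lambda>m. (2 * real m ^ 4 + 1) ^ D * (2 * (real m * real (g m)) + 1) ^ D * (1 - p ^ (m * g m)) ^ (L m - 1))"
proof (rule summable_comparison_test_ev)
  define a where "a = - ln p"
  have a: "0 < a" using p by (simp add: a_def)
  have "eventually (\<lambda>m. (2 * real m ^ 4 + 1) ^ D * (2 * (real m * real m powr \<beta>) + 1) ^ D * exp (- real m) \<le> 1 / real m ^ 2) sequentially"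
  proof -
    have "((\<lambda>m. ((2 * real m ^ 4 + 1) * (2 * (real m * real m powr \<beta>) + 1)) powr real D * exp (- real m) * real m ^ 2) \<longlongrightarrow> 0) sequentially"
      using \<beta> by real_asymp
    hence "eventually (\<lambda>m. ((2 * real m ^ 4 + 1) * (2 * (real m * real m powr \<beta>) + 1)) powr real D * exp (- real m) * real m ^ 2 < 1) sequentially"
      by (rule order_tendstoD) simp
    with eventually_gt_at_top[of 0] show ?thesis
    proof eventually_elim
      case (elim m)
      have "0 < (2 * real m ^ 4 + 1) * (2 * (real m * real m powr \<beta>) + 1)"
        by (intro mult_pos_pos add_nonneg_pos) auto
      hence "((2 * real m ^ 4 + 1) * (2 * (real m * real m powr \<beta>) + 1)) powr real D =
          (2 * real m ^ 4 + 1) ^ D * (2 * (real m * real m powr \<beta>) + 1) ^ D"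
        by (simp only: powr_realpow power_mult_distrib)
      with elim show ?case by (simp add: pos_le_divide_eq)
    qed
  qed
  \<comment> \<open>The right-hand side is a lower bound for the expected number of followers among
    L m - 1 particles.\<close>
  moreover have "eventually (\<lambda>m. real m \<le> exp (- (a * (real m * real m powr \<beta>))) * (exp (real m powr (1 + 2 * \<beta>)) - 1)) sequentially"
    using a \<beta> by real_asymp
  ultimately show "eventually (\<lambda>m. norm ((2 * real m ^ 4 + 1) ^ D * (2 * (real m * real (g m)) + 1) ^ D *
      (1 - p ^ (m * g m)) ^ (L m - 1)) \<le> 1 / real m ^ 2) sequentially"
  proof eventually_elim
    case (elim m)
    have g: "real (g m) \<le> real m powr \<beta>" unfolding g_def by simp
    have pn: "0 \<le> p ^ (m * g m)" "p ^ (m * g m) \<le> 1" using p by (auto simp: power_le_one)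
    have "exp (- (a * (real m * real m powr \<beta>))) \<le> exp (- (a * (real m * real (g m))))"
      using g a by (simp add: mult_left_mono)
    also have "\<dots> = p ^ (m * g m)"
      using p by (simp add: a_def exp_of_nat_mult[symmetric] powr_def powr_realpow[symmetric] mult.commute)
    finally have pge: "exp (- (a * (real m * real m powr \<beta>))) \<le> p ^ (m * g m)" .
    have L: "exp (real m powr (1 + 2 * \<beta>)) \<le> real (L m)" unfolding L_def by linarith
    hence "0 < real (L m)" by (rule less_le_trans[OF exp_gt_zero])
    hence "real (L m - 1) = real (L m) - 1" by (subst of_nat_diff) auto
    hence L1: "exp (real m powr (1 + 2 * \<beta>)) - 1 \<le> real (L m - 1)" using L by simp
    have "real m \<le> p ^ (m * g m) * real (L m - 1)"
      by (rule order_trans[OF elim(2) mult_mono[OF pge L1]]) (use p in auto)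
    hence "exp (- (p ^ (m * g m) * real (L m - 1))) \<le> exp (- real m)" by simp
    with one_minus_power_le_exp[OF pn, of "L m - 1"]
    have miss: "(1 - p ^ (m * g m)) ^ (L m - 1) \<le> exp (- real m)" by linarith
    have "(2 * real m ^ 4 + 1) ^ D * (2 * (real m * real (g m)) + 1) ^ D * (1 - p ^ (m * g m)) ^ (L m - 1) \<le>
        (2 * real m ^ 4 + 1) ^ D * (2 * (real m * real m powr \<beta>) + 1) ^ D * exp (- real m)"
      using g pn miss
      by (intro mult_mono power_mono add_right_mono mult_left_mono order_refl) auto
    with elim(1) pn show ?case by simp
  qed
qed (use inverse_power_summable[of 2, where 'a = real] in \<open>simp add: field_simps\<close>)

section \<open>The shape theorem\<close>

text \<open>\<open>walk_space\<close> lives on arbitrary sequences of integer vectors; that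
  increments are unit steps holds only almost surely, as countably many conditions.\<close>

lemma AE_walk_space_unit_steps:
  fixes \<omega> :: "int ^ 'd::finite \<Rightarrow> nat"
  shows "AE w in walk_space \<omega>. \<forall>x k i. 1 \<le> k \<longrightarrow> k \<le> \<omega> x \<longrightarrow> w (x, k) i \<in> unit_steps"
  unfolding AE_all_countable
proof (intro allI)
  fix x :: "int ^ 'd" and k i
  have "AE s in measure_pmf (pmf_of_set unit_steps). s \<in> (unit_steps :: (int ^ 'd) set)"
    by (simp add: AE_measure_pmf_iff)
  hence step: "AE a in srw_increments. a i \<in> (unit_steps :: (int ^ 'd) set)"
    unfolding srw_increments_def
    by (intro AE_PiM_component) (auto intro: measure_pmf.prob_space_axioms)
  show "AE w in walk_space \<omega>. 1 \<le> k \<longrightarrow> k \<le> \<omega> x \<longrightarrow> w (x, k) i \<in> unit_steps"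
  proof (cases "1 \<le> k \<and> k \<le> \<omega> x")
    case True
    have "AE w in walk_space \<omega>. w (x, k) i \<in> unit_steps"
      unfolding walk_space_def
      by (rule AE_PiM_component[where P = "\<lambda>a. a i \<in> unit_steps" and i = "(x, k)" and M = "\<lambda>_. srw_increments"])
         (use True step in \<open>auto intro: srw.prob_space_axioms\<close>)
    thus ?thesis by eventually_elim simp
  qed simp
qed

text \<open>This realises the independence of the first walk at the origin from all others as a
  product measure. The hypothesis ensures that this particle exists.\<close>

lemma walk_space_resample:
  assumes "1 \<le> \<omega> 0"
  shows "distr (srw_increments \<Otimes>\<^sub>M walk_space \<omega>) (walk_space \<omega>) (\<lambda>(a, w). w((0, 1) := a)) = walk_space \<omega>"
proof -
  have "insert (0, 1) {(x, k). 1 \<le> k \<and> k \<le> \<omega> x} = {(x, k). 1 \<le> k \<and> k \<le> \<omega> x}"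
    using assms by auto
  thus ?thesis
    using distr_pair_PiM_eq_PiM[of "{(x, k). 1 \<le> k \<and> k \<le> \<omega> x}" "\<lambda>_. srw_increments" "(0, 1)"]
    by (simp add: walk_space_def srw.prob_space_axioms)
qed

lemma measurable_walk_space_resample:
  assumes "1 \<le> \<omega> 0"
  shows "(\<lambda>(a, w). w((0, 1) := a)) \<in> measurable (srw_increments \<Otimes>\<^sub>M walk_space \<omega>) (walk_space \<omega>)"
proof -
  have "insert (0, 1) {(x, k). 1 \<le> k \<and> k \<le> \<omega> x} = {(x, k). 1 \<le> k \<and> k \<le> \<omega> x}"
    using assms by auto
  hence "{(x, k). 1 \<le> k \<and> k \<le> \<omega> x} = {(x, k). 1 \<le> k \<and> k \<le> \<omega> x} \<union> {(0, 1)}" by blast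
  thus ?thesis
    unfolding walk_space_def case_prod_beta by (rule measurable_fun_upd) measurable
qed

text \<open>The first walk is drawn separately. Given it, its range is a fixed set to which
  \<open>AE_followed_around\<close> applies; writing it into the other walks changes neither the
  configuration nor the followed geodesics.\<close>

lemma AE_walk_space_good_start:
  fixes \<omega> :: "int ^ 'd::finite \<Rightarrow> nat"
  assumes origin: "1 \<le> \<omega> 0"
    and good: "AE a in srw_increments. \<forall>K0. \<exists>K\<ge>K0. \<exists>x\<in>range (\<lambda>n. \<Sum>i<n. a i). good_site L \<omega> x K"
    and summ: "summable (\<lambda>m. (2 * real m ^ 4 + 1) ^ CARD('d) * (2 * (real m * real (g m)) + 1) ^ CARD('d) *
      (1 - (1 / (2 * real CARD('d))) ^ (m * g m)) ^ (L m - 1))"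
  shows "AE w in walk_space \<omega>. \<exists>K\<ge>K0. \<exists>x n. walk w 0 1 n = x \<and> good_site L \<omega> x K \<and> followed_around L g \<omega> w x K"
proof -
  let ?S = "srw_increments :: (nat \<Rightarrow> int ^ 'd) measure" and ?W = "walk_space \<omega>"
  let ?upd = "\<lambda>(a, w). w((0, 1) := a)"
  define R where "R w \<longleftrightarrow> (\<exists>K\<ge>K0. \<exists>x n. walk w 0 1 n = x \<and> good_site L \<omega> x K \<and> followed_around L g \<omega> w x K)" for w
  have first: "(\<lambda>w. w (0, 1)) \<in> measurable ?W ?S"
    unfolding walk_space_def using origin by (intro measurable_component_singleton) auto
  have [measurable]: "(\<lambda>w. walk w 0 1 n) \<in> measurable ?W (count_space UNIV)" for n
    using measurable_compose[OF first measurable_partial_sum] by (simp add: walk_def)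
  have R: "{w \<in> space ?W. R w} \<in> sets ?W" unfolding R_def by measurable
  interpret W: prob_space ?W
    unfolding walk_space_def by (intro prob_space_PiM srw.prob_space_axioms)
  interpret pair: pair_sigma_finite ?S ?W by unfold_locales
  have "AE p in ?S \<Otimes>\<^sub>M ?W. R (?upd p)"
  proof (rule pair.AE_pair_measure)
    show "{p \<in> space (?S \<Otimes>\<^sub>M ?W). R (?upd p)} \<in> sets (?S \<Otimes>\<^sub>M ?W)"
      using measurable_compose[OF measurable_walk_space_resample[of \<omega>, OF origin] R[folded pred_def]]
      by (simp add: pred_def)
    show "AE a in ?S. AE w in ?W. R (?upd (a, w))"
      using good
    proof eventually_elim
      case (elim a)
      have "AE w in ?W. \<exists>K\<ge>K0. \<exists>x\<in>range (\<lambda>n. \<Sum>i<n. a i). good_site L \<omega> x K \<and> followed_around L g \<omega> w x K"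
        by (rule AE_followed_around[OF _ summ]) (use elim in blast)
      thus ?case
      proof eventually_elim
        case (elim w)
        then obtain K n where K: "K \<ge> K0" "good_site L \<omega> (\<Sum>i<n. a i) K" "followed_around L g \<omega> w (\<Sum>i<n. a i) K"
          by blast
        have "walk (w((0, 1) := a)) 0 1 n = (\<Sum>i<n. a i)" by (simp add: walk_def)
        moreover have "followed_around L g \<omega> (w((0, 1) := a)) (\<Sum>i<n. a i) K"
          unfolding followed_around_fun_upd by (rule K(3))
        ultimately show ?case unfolding R_def case_prod_conv using K(1,2) by blast
      qed
    qed
  qed
  hence "AE w in distr (?S \<Otimes>\<^sub>M ?W) ?W ?upd. R w"
    by (subst AE_distr_iff[OF measurable_walk_space_resample[of \<omega>, OF origin] R])
  thus ?thesis unfolding walk_space_resample[of \<omega>, OF origin] R_def .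
qed

theorem theorem2:
  fixes \<mu> :: "nat pmf" and \<delta> :: real
  assumes "0 < \<delta>" and "\<delta> < real CARD('d::finite)"
    and "eventually (\<lambda>n. measure_pmf.prob \<mu> {n..} \<ge> ln (real n) powr (- \<delta>)) sequentially"
  shows "AE \<omega> in PiM (UNIV :: (int ^ 'd) set) (\<lambda>_. measure_pmf \<mu>).
           \<omega> 0 \<ge> 1 \<longrightarrow>
           (\<forall>\<epsilon>::real. 0 < \<epsilon> \<and> \<epsilon> < 1 \<longrightarrow>
              (AE w in walk_space \<omega>.
                 eventually (\<lambda>n.
                   (\<lambda>p. (1 - \<epsilon>) *\<^sub>R p) ` (l1_ball :: (real ^ 'd) set)
                     \<subseteq> (\<lambda>p. (1 / real n) *\<^sub>R p) ` frog_xibar \<omega> w n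
                   \<and> (\<lambda>p. (1 / real n) *\<^sub>R p) ` frog_xibar \<omega> w n
                     \<subseteq> (\<lambda>p. (1 + \<epsilon>) *\<^sub>R p) ` l1_ball) sequentially))"
proof -
  let ?d = "CARD('d)"
  \<comment> \<open>With this value (1 + 2 * \<beta>) * \<delta> is the midpoint of \<delta> and d:
    below d for rich cubes, while \<beta> > 0 lets g m tend to infinity.\<close>
  define \<beta> where "\<beta> = (real ?d / \<delta> - 1) / 4"
  define L where "L m = nat \<lceil>exp (real m powr (1 + 2 * \<beta>))\<rceil>" for m :: nat
  define g where "g m = nat \<lfloor>real m powr \<beta>\<rfloor>" for m :: nat
  have \<beta>: "0 < \<beta>" using assms(1,2) by (simp add: \<beta>_def)
  have "(1 + 2 * \<beta>) * \<delta> < real ?d" using assms(1,2) by (simp add: \<beta>_def field_simps)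
  with \<beta> have poor: "summable (\<lambda>m. real m ^ ?d * (2 * real m ^ 4 + 1) ^ ?d * measure_pmf.prob \<mu> {..<L m} ^ (m ^ ?d))"
    unfolding L_def by (intro summable_poor_cubes[OF assms(1,3)]) auto
  have missed: "summable (\<lambda>m. (2 * real m ^ 4 + 1) ^ ?d * (2 * (real m * real (g m)) + 1) ^ ?d *
      (1 - (1 / (2 * real ?d)) ^ (m * g m)) ^ (L m - 1))"
  proof -
    have "1 \<le> real ?d" by (simp add: Suc_le_eq)
    hence "1 < 2 * real ?d" by linarith
    thus ?thesis unfolding L_def g_def by (intro summable_missed_targets \<beta>) simp_all
  qed
  have g: "filterlim g at_top sequentially" unfolding g_def using \<beta> by real_asymp
  \<comment> \<open>From \<open>K0\<close> on the climb stays in its window and every hop makes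
    progress; the starting scale is chosen beyond it.\<close>
  obtain K0 where K0: "\<And>m. K0 \<le> m \<Longrightarrow> ?d \<le> m \<and> 2 * ?d < g m"
  proof -
    have "eventually (\<lambda>m. 2 * ?d + 1 \<le> g m) sequentially"
      using g unfolding filterlim_at_top by blast
    with eventually_ge_at_top[of ?d] have "eventually (\<lambda>m. ?d \<le> m \<and> 2 * ?d < g m) sequentially"
      by eventually_elim simp
    thus thesis using that unfolding eventually_sequentially by blast
  qed
  show ?thesis
    using AE_AE_good_site[OF poor]
  proof eventually_elim
    case (elim \<omega>)
    show ?case
    proof (intro impI allI)
      \<comment> \<open>The property of the configuration obtained above does not involve
        \<epsilon>, so one exceptional null set of configurations serves all \<epsilon>.\<close>
      fix \<epsilon> :: real
      assume origin: "1 \<le> \<omega> 0" and \<epsilon>: "0 < \<epsilon> \<and> \<epsilon> < 1"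
      show "AE w in walk_space \<omega>. eventually (\<lambda>n.
          (\<lambda>p. (1 - \<epsilon>) *\<^sub>R p) ` (l1_ball :: (real ^ 'd) set) \<subseteq> (\<lambda>p. (1 / real n) *\<^sub>R p) ` frog_xibar \<omega> w n
          \<and> (\<lambda>p. (1 / real n) *\<^sub>R p) ` frog_xibar \<omega> w n \<subseteq> (\<lambda>p. (1 + \<epsilon>) *\<^sub>R p) ` l1_ball) sequentially"
        using AE_walk_space_good_start[OF origin elim missed, of K0] AE_walk_space_unit_steps[of \<omega>]
      proof eventually_elim
        case (elim w)
        from elim(1) obtain K n where K: "K0 \<le> K" "good_site L \<omega> (walk w 0 1 n) K"
          "followed_around L g \<omega> w (walk w 0 1 n) K" by blast
        have K_large: "?d \<le> m \<and> 2 * ?d < g m" if "K \<le> m" for m using K0[of m] K(1) that by simp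
        \<comment> \<open>The first particle itself walks to the rich site, so the finite time
          \<open>n\<close> of its visit is the initial delay.\<close>
        have start: "frog_T \<omega> w 0 (walk w 0 1 n) \<le> enat n"
          by (rule order_trans[OF frog_T_le_frog_t frog_t_le[of 1]]) (use origin in auto)
        have steps: "w (x, k) i \<in> unit_steps" if "1 \<le> k" "k \<le> \<omega> x" for x k i
          using elim(2) that by blast
        have "eventually (\<lambda>n. \<forall>z. real (l1norm z) \<le> (1 - \<epsilon>) * real n + real ?d \<longrightarrow> frog_T \<omega> w 0 z \<le> enat n) sequentially"
          by (rule eventually_covered[OF K(2) followed_around_imp_fast_around[OF K(3)] K_large g start])
             (use \<epsilon> in auto)
        moreover have "eventually (\<lambda>n. real ?d \<le> \<epsilon> * real n) sequentially" using \<epsilon> by real_asymp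
        ultimately show ?case using eventually_gt_at_top[of 0]
        proof eventually_elim
          case (elim n)
          show ?case
          proof
            show "(\<lambda>p. (1 - \<epsilon>) *\<^sub>R p) ` l1_ball \<subseteq> (\<lambda>p. (1 / real n) *\<^sub>R p) ` frog_xibar \<omega> w n"
              by (rule scaled_l1_ball_subset_xibar[OF elim(3) _ elim(1)]) (use \<epsilon> in simp)
            show "(\<lambda>p. (1 / real n) *\<^sub>R p) ` frog_xibar \<omega> w n \<subseteq> (\<lambda>p. (1 + \<epsilon>) *\<^sub>R p) ` l1_ball"
              by (rule scaled_xibar_subset_l1_ball[OF elim(3) _ elim(2)]) (use \<epsilon> steps in auto)
          qed
        qed
      qed
    qed
  qed
qed

end
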